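(* Let $m,n\ge 1$ be integers. For any $\epsilon>0$, there exists $\delta>0$ such that for all $b\in\mathbb{R}^m$, $$\dim_H \mathbf{Bad}^b(\epsilon)<mn-\delta .$$
   Context: $M_{m,n}(\mathbb{R})$ is the set of $m\times n$ real matrices, identified with $\mathbb{R}^{mn}$; $\|\cdot\|$ is the Euclidean norm; $\dim_H$ is Hausdorff dimension. For $v\in\mathbb{R}^m$, $\langle v\rangle:=\inf_{p\in\mathbb{Z}^m}\|v-p\|$. For $\epsilon>0$, a matrix $A\in M_{m,n}(\mathbb{R})$ is called $\epsilon$-bad for $b\in\mathbb{R}^m$ if $$\liminf_{q\in\mathbb{Z}^n,\ \|q\|\to\infty}\|q\|^{n/m}\langle Aq-b\rangle\ge\epsilon .$$ $\mathbf{Bad}^b(\epsilon):=\{A\in M_{m,n}(\mathbb{R}): A \text{ is } \epsilon\text{-bad for } b\}$. *)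

theory Defs
  imports "HOL-Analysis.Analysis"
begin

(* The HOL-Analysis function diameter is only meaningful on bounded sets, so covers by
   unbounded sets are excluded; they could never satisfy the diameter bound anyway.
   The zero-dimensional gauge counts nonempty sets, and is treated apart because
   0 powr 0 = 0 in HOL. *)
definition hausdorff_gauge :: "real \<Rightarrow> 'a::metric_space set \<Rightarrow> ennreal" where
  "hausdorff_gauge s U =
     (if U = {} then 0 else if s = 0 then 1 else ennreal (diameter U powr s))"

definition hausdorff_premeasure :: "real \<Rightarrow> real \<Rightarrow> 'a::metric_space set \<Rightarrow> ennreal" where
  "hausdorff_premeasure s r S =
     (INF U \<in> {U :: nat \<Rightarrow> 'a set. S \<subseteq> (\<Union>i. U i) \<and> (\<forall>i. bounded (U i) \<and> diameter (U i) \<le> r)}.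
        (\<Sum>i. hausdorff_gauge s (U i)))"

definition hausdorff_measure :: "real \<Rightarrow> 'a::metric_space set \<Rightarrow> ennreal" where
  "hausdorff_measure s S = (SUP r \<in> {0<..}. hausdorff_premeasure s r S)"

(* The empty set gets dimension 0; a set with no null exponent gets dimension \<infinity>. *)
definition hausdorff_dim :: "'a::metric_space set \<Rightarrow> ereal" where
  "hausdorff_dim S = (INF s \<in> {s. 0 \<le> s \<and> hausdorff_measure s S = 0}. ereal s)"

definition int_lattice :: "(real ^ 'k) set" where
  "int_lattice = {p. \<forall>i. p $ i \<in> \<int>}"

definition lattice_dist :: "real ^ 'k \<Rightarrow> real" where
  "lattice_dist v = (INF p \<in> int_lattice. norm (v - p))"

(* Elements of real ^ 'n ^ 'm are the m-by-n matrices with m = CARD('m), n = CARD('n).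
   The lower limit is taken along the lattice points q whose norm tends to infinity,
   with values in ereal because it may be infinite. *)
definition eps_bad :: "real \<Rightarrow> real ^ 'm \<Rightarrow> real ^ 'n ^ 'm \<Rightarrow> bool" where
  "eps_bad \<epsilon> b A \<longleftrightarrow>
     Liminf (inf at_infinity (principal int_lattice))
       (\<lambda>q. ereal (norm q powr (real CARD('n) / real CARD('m)) * lattice_dist (A *v q - b)))
     \<ge> ereal \<epsilon>"

(* The norm on real ^ 'n ^ 'm is the Euclidean norm of the mn entries, so that the metric
   used by hausdorff_dim on this set is that of R^(mn). *)
definition Bad :: "real ^ 'm \<Rightarrow> real \<Rightarrow> (real ^ 'n ^ 'm) set" where
  "Bad b \<epsilon> = {A. eps_bad \<epsilon> b A}"

end

theory Submission
  imports Defs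
begin

text \<open>Write m, n for the numbers of rows and columns and d = m + n. A matrix A and a scale t > 0 give a
lattice in \<open>\<real>\<^sup>d\<close>, the set of all \<open>(t\<^sup>n (A q - p), q / t\<^sup>m)\<close> with p, q integral; it has covolume 1, and
boxes of sup-norm radius r in this picture encode the inequalities \<open>\<bar>A q - p\<bar> \<le> r t\<^sup>-\<^sup>n\<close>, \<open>\<bar>q\<bar> \<le> r t\<^sup>m\<close>.
Moving A by at most \<open>t\<^sup>-\<^sup>d\<close> in each entry changes the lattice by a bounded distortion only, so that cubes
of side \<open>t\<^sup>-\<^sup>d\<close> are the natural cells at scale t.

If the lattice vectors in a box of bounded size span \<open>\<real>\<^sup>d\<close>, then every target is within bounded distance
of a lattice point. Applied to a target built from b, this gives q of size about \<open>t\<^sup>m\<close> with A q within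
about \<open>t\<^sup>-\<^sup>n\<close> of b modulo integers, and a suitable matrix in the cell of A satisfies A' q = b
modulo integers exactly. A whole subcell around A', a bounded number of scales further down, then
consists of matrices that approximate b better than \<open>\<epsilon>\<close> allows (\<open>hit_cell\<close>). So such cells lose a fixed
proportion of their volume. The argument breaks down for cells near matrices with a rational
dependency, where the lattice has very short vectors: if A is rational and b is not, no approximation
need exist at any scale near A.

The number of lattice points in the unit box, called the height, measures this degeneracy, and it
contracts on average under subdivision (\<open>height_drift\<close>): the mean of the heights of the cells into which
a cell is divided is at most half of the height of that cell, plus a constant. The reason is a
dichotomy. If the lattice vectors in a certain large box span, then the number of points in that box is
bounded in terms of its volume alone, and all subcells have bounded height. Otherwise these vectors lie
in a hyperplane, so that their number grows in the radius r only like \<open>r\<^sup>d\<^sup>-\<^sup>1\<close>, which is slower by one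
power of r than what would be needed to keep the average height constant. A pigeonhole lower bound for
the number of lattice points shows conversely that bounded height forces spanning in a bounded box
(\<open>spanning_if_height_le\<close>).

Combining the two effects, the potential height + K, summed over the subcells that still meet the set
of badly approximable matrices, decreases by a factor 1 - c relative to the number of all subcells
(\<open>potential_decay\<close>): high cells lose potential by the drift, and low cells lose a subcell. The constants
depend on \<open>\<epsilon>\<close>, m and n, but not on b. Hence after j subdivisions with ratio \<open>P\<^sup>d\<close> of the side lengths at most
a constant times \<open>((1 - c) P\<^sup>d\<^sup>m\<^sup>n)\<^sup>j\<close> cells are left, which bounds the dimension by mn + log (1 - c) / (d log P).\<close>

section \<open>Counting tools\<close>

lemma card_le_card_image_times:
  assumes "finite A" and fib: "\<And>y. y \<in> f ` A \<Longrightarrow> card {x \<in> A. f x = y} \<le> c"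
  shows "card A \<le> card (f ` A) * c"
proof -
  have "A = (\<Union>y\<in>f ` A. {x \<in> A. f x = y})" by auto
  then have "card A \<le> (\<Sum>y\<in>f ` A. card {x \<in> A. f x = y})"
    using card_UN_le[of "f ` A" "\<lambda>y. {x \<in> A. f x = y}"] assms(1) by simp
  also have "\<dots> \<le> (\<Sum>y\<in>f ` A. c)" by (intro sum_mono fib)
  finally show ?thesis by simp
qed

lemma vec_product_set:
  fixes S :: "'d::finite \<Rightarrow> 'a set"
  assumes "\<And>i. finite (S i)"
  shows finite_vec_product: "finite {x :: 'a ^ 'd. \<forall>i. x $ i \<in> S i}"
    and card_vec_product: "card {x :: 'a ^ 'd. \<forall>i. x $ i \<in> S i} = (\<Prod>i\<in>UNIV. card (S i))"
proof -
  have "bij_betw vec_nth {x :: 'a ^ 'd. \<forall>i. x $ i \<in> S i} (\<Pi>\<^sub>E i\<in>UNIV. S i)"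
    by (rule bij_betwI[where g = vec_lambda]) auto
  note * = bij_betw_finite[OF this] bij_betw_same_card[OF this]
  show "finite {x :: 'a ^ 'd. \<forall>i. x $ i \<in> S i}"
    using * by (simp add: assms finite_PiE)
  show "card {x :: 'a ^ 'd. \<forall>i. x $ i \<in> S i} = (\<Prod>i\<in>UNIV. card (S i))"
    using * by (simp add: card_PiE)
qed

lemma Ints_in_interval:
  fixes l u :: real
  shows finite_Ints_interval: "finite {x \<in> \<int>. l \<le> x \<and> x \<le> u}"
    and card_Ints_interval: "l \<le> u + 1 \<Longrightarrow> real (card {x \<in> \<int>. l \<le> x \<and> x \<le> u}) \<le> u - l + 1"
proof -
  have eq: "{x \<in> \<int>. l \<le> x \<and> x \<le> u} = real_of_int ` {\<lceil>l\<rceil>..\<lfloor>u\<rfloor>}"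
    by (auto elim!: Ints_cases simp: ceiling_le_iff le_floor_iff)
  show "finite {x \<in> \<int>. l \<le> x \<and> x \<le> u}" unfolding eq by simp
  assume lu: "l \<le> u + 1"
  have "card {x \<in> \<int>. l \<le> x \<and> x \<le> u} = nat (\<lfloor>u\<rfloor> - \<lceil>l\<rceil> + 1)"
    unfolding eq by (subst card_image) (auto simp: inj_on_def)
  then show "real (card {x \<in> \<int>. l \<le> x \<and> x \<le> u}) \<le> u - l + 1"
    using lu by linarith
qed

lemma finite_vec_less: "finite {x :: nat ^ 'n. \<forall>j. x $ j < N}"
  using finite_vec_product[of "\<lambda>_. {..<N}"] by simp

lemma sum_UN_le_nonneg:
  fixes f :: "'b \<Rightarrow> real"
  assumes "finite I" "\<And>i. i \<in> I \<Longrightarrow> finite (A i)" "\<And>x. 0 \<le> f x"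
  shows "sum f (\<Union>i\<in>I. A i) \<le> (\<Sum>i\<in>I. sum f (A i))"
  using assms(1,2)
proof (induction I)
  case (insert i I)
  have "sum f (A i \<union> (\<Union>i\<in>I. A i)) + sum f (A i \<inter> (\<Union>i\<in>I. A i)) = sum f (A i) + sum f (\<Union>i\<in>I. A i)"
    using insert.prems insert.hyps by (intro sum.union_inter) auto
  moreover have "0 \<le> sum f (A i \<inter> (\<Union>i\<in>I. A i))" using assms(3) by (simp add: sum_nonneg)
  moreover have "sum f (\<Union>i\<in>I. A i) \<le> (\<Sum>i\<in>I. sum f (A i))" using insert by simp
  ultimately show ?case using insert.hyps by simp
qed simp

lemma infnorm_le_iff:
  fixes x :: "real ^ 'd"
  shows "infnorm x \<le> r \<longleftrightarrow> (\<forall>i. \<bar>x $ i\<bar> \<le> r)"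
proof
  assume "\<forall>i. \<bar>x $ i\<bar> \<le> r"
  then show "infnorm x \<le> r"
    unfolding infnorm_cart by (intro cSup_least) auto
qed (meson component_le_infnorm_cart order_trans)

lemma infnorm_diff_le:
  fixes x y :: "'a::euclidean_space"
  assumes "infnorm x \<le> a" "infnorm y \<le> b"
  shows "infnorm (x - y) \<le> a + b"
  using infnorm_triangle[of x "- y"] assms by (simp add: infnorm_neg)

section \<open>Discrete subgroups and boxes\<close>

definition box_points :: "'a::euclidean_space set \<Rightarrow> real \<Rightarrow> 'a set" where
  "box_points \<Lambda> r = {x \<in> \<Lambda>. infnorm x \<le> r}"

text \<open>Covolume enters through counting: by an upper bound for the number of points in very large boxes, and
for the lattices of interest by a pigeonhole lower bound in bounded boxes.\<close>

locale discrete_subgroup =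
  fixes \<Lambda> :: "(real ^ 'd) set"
  assumes zero_mem: "0 \<in> \<Lambda>"
    and diff_mem: "x \<in> \<Lambda> \<Longrightarrow> y \<in> \<Lambda> \<Longrightarrow> x - y \<in> \<Lambda>"
    and finite_box_points: "finite (box_points \<Lambda> r)"
begin

lemma add_mem: "x \<in> \<Lambda> \<Longrightarrow> y \<in> \<Lambda> \<Longrightarrow> x + y \<in> \<Lambda>"
  using diff_mem[of x "0 - y"] diff_mem[of 0 y] zero_mem by simp

lemma neg_mem: "x \<in> \<Lambda> \<Longrightarrow> - x \<in> \<Lambda>"
  using diff_mem[of 0 x] zero_mem by simp

lemma nat_scale_mem: "x \<in> \<Lambda> \<Longrightarrow> real k *\<^sub>R x \<in> \<Lambda>"
  by (induction k) (auto simp: zero_mem add_mem scaleR_add_left)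

lemma int_scale_mem: "x \<in> \<Lambda> \<Longrightarrow> real_of_int k *\<^sub>R x \<in> \<Lambda>"
  using nat_scale_mem[of x "nat k"] neg_mem[OF nat_scale_mem[of x "nat (- k)"]]
  by (cases "k \<ge> 0") auto

lemma sum_mem: "(\<And>i. i \<in> I \<Longrightarrow> f i \<in> \<Lambda>) \<Longrightarrow> sum f I \<in> \<Lambda>"
  by (induction I rule: infinite_finite_induct) (auto simp: zero_mem add_mem)

lemma one_le_card_box_points: "0 \<le> r \<Longrightarrow> 1 \<le> card (box_points \<Lambda> r)"
proof -
  assume "0 \<le> r"
  then have "0 \<in> box_points \<Lambda> r" by (simp add: box_points_def zero_mem infnorm_0)
  then show ?thesis using finite_box_points card_gt_0_iff by (metis One_nat_def Suc_leI empty_iff)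
qed

text \<open>A nonzero vector in the small box has a multiple of norm between 2/22 and 3/22. The translates of the
small box by the first eight multiples of that vector are disjoint and stay inside the unit box, so the
unit box contains at least eight times as many points. If there is no nonzero vector, the small box
contributes just the origin.\<close>

lemma card_small_box_le: "8 * card (box_points \<Lambda> (1/22)) \<le> 8 + card (box_points \<Lambda> 1)"
proof (cases "\<exists>w\<in>box_points \<Lambda> (1/22). w \<noteq> 0")
  case False
  then have "box_points \<Lambda> (1/22) \<subseteq> {0}" by auto
  then have "card (box_points \<Lambda> (1/22)) \<le> 1" by (metis card_mono finite.emptyI finite.insertI is_singletonI is_singleton_altdef)
  then show ?thesis by simp
next
  case True
  define s :: real where "s = 1/22"
  obtain w where w: "w \<in> \<Lambda>" "infnorm w \<le> s" "w \<noteq> 0"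
    using True by (auto simp: box_points_def s_def)
  define \<mu> where "\<mu> = infnorm w"
  have \<mu>: "0 < \<mu>" "\<mu> \<le> s" using w by (auto simp: \<mu>_def infnorm_pos_lt)
  \<comment> \<open>The least multiple of w whose norm exceeds 2s; as w has norm at most s, it is at most 3s.\<close>
  define k where "k = nat (\<lfloor>2 * s / \<mu>\<rfloor> + 1)"
  define v where "v = real k *\<^sub>R w"
  have k: "2 * s / \<mu> < real k" "real k \<le> 2 * s / \<mu> + 1"
    using \<mu> by (auto simp: k_def s_def)
  have v: "v \<in> \<Lambda>" "2 * s < infnorm v" "infnorm v \<le> 3 * s"
    using k \<mu> w by (auto simp: v_def nat_scale_mem infnorm_mul simp flip: \<mu>_def simp: field_simps)
  define F where "F = (\<lambda>(x, j). x + real j *\<^sub>R v)"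
  have "inj_on F (box_points \<Lambda> s \<times> {..<8::nat})"
  proof (rule inj_onI, clarsimp simp: F_def)
    fix x y :: "real ^ 'd" and i j :: nat
    assume *: "x \<in> box_points \<Lambda> s" "y \<in> box_points \<Lambda> s" "x + real i *\<^sub>R v = y + real j *\<^sub>R v"
    then have "(real i - real j) *\<^sub>R v = y - x" by (simp add: algebra_simps)
    then have "\<bar>real i - real j\<bar> * infnorm v \<le> s + s"
      using infnorm_diff_le[of y s x s] * by (metis (lifting) infnorm_mul mem_Collect_eq box_points_def)
    moreover have "infnorm v \<le> \<bar>real i - real j\<bar> * infnorm v" if "i \<noteq> j"
      using that mult_right_mono[of 1 "\<bar>real i - real j\<bar>" "infnorm v"] by (simp add: infnorm_pos_le)
    ultimately have "i = j" using v(2) by (rule_tac ccontr) linarith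
    then show "x = y \<and> i = j" using * by simp
  qed
  moreover have "F ` (box_points \<Lambda> s \<times> {..<8}) \<subseteq> box_points \<Lambda> 1"
  proof (clarsimp simp: F_def)
    fix x and j :: nat assume *: "x \<in> box_points \<Lambda> s" "j < 8"
    have "infnorm (x + real j *\<^sub>R v) \<le> infnorm x + real j * infnorm v"
      using infnorm_triangle[of x "real j *\<^sub>R v"] by (simp add: infnorm_mul)
    also have "\<dots> \<le> s + 7 * (3 * s)"
      using * v by (intro add_mono mult_mono) (auto simp: box_points_def infnorm_pos_le)
    finally show "x + real j *\<^sub>R v \<in> box_points \<Lambda> 1"
      using * v by (auto simp: box_points_def s_def add_mem nat_scale_mem)
  qed
  ultimately have "card (box_points \<Lambda> s \<times> {..<8::nat}) \<le> card (box_points \<Lambda> 1)"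
    using card_inj_on_le finite_box_points by blast
  then show ?thesis by (simp add: card_cartesian_product s_def)
qed

text \<open>On a hyperplane the coordinate whose coefficient is largest in absolute value is determined by the
others, with Lipschitz constant at most d - 1. Hence points of the hyperplane whose other d - 1
coordinates agree up to 1/d differ by a vector of norm at most 1, and at most \<open>N(1)\<close> lattice points share
the same discretised coordinates, where \<open>N(1)\<close> counts the unit box.\<close>

lemma card_box_le_in_hyperplane:
  fixes r :: real
  assumes r: "1 \<le> r" and nspan: "span (box_points \<Lambda> r) \<noteq> UNIV"
  shows "real (card (box_points \<Lambda> r)) \<le> (4 * CARD('d) * r) ^ (CARD('d) - 1) * card (box_points \<Lambda> 1)"
proof -
  define d where "d = real CARD('d)"
  have d1: "d \<ge> 1" by (simp add: d_def Suc_leI)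
  obtain a where a: "a \<noteq> 0" "span (box_points \<Lambda> r) \<subseteq> {x. a \<bullet> x = 0}"
    using span_not_univ_subset_hyperplane[OF nspan] by blast
  have "Max (range (\<lambda>i. \<bar>a $ i\<bar>)) \<in> range (\<lambda>i. \<bar>a $ i\<bar>)" by (intro Max_in) auto
  then obtain i0 where "\<bar>a $ i0\<bar> = Max (range (\<lambda>i. \<bar>a $ i\<bar>))" by (metis imageE)
  then have i0: "\<bar>a $ i\<bar> \<le> \<bar>a $ i0\<bar>" for i by simp
  have a0: "a $ i0 \<noteq> 0" using a(1) i0 by (metis abs_le_zero_iff abs_zero vec_eq_iff zero_index)
  have diff: "infnorm (x - y) \<le> 1"
    if xy: "x \<in> box_points \<Lambda> r" "y \<in> box_points \<Lambda> r" and c: "\<And>i. i \<noteq> i0 \<Longrightarrow> \<bar>x $ i - y $ i\<bar> \<le> 1 / d" for x y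
  proof -
    have "a \<bullet> (x - y) = 0" using xy subsetD[OF a(2) span_base] by (auto simp: inner_diff_right)
    then have "a $ i0 * (x - y) $ i0 + (\<Sum>i\<in>UNIV - {i0}. a $ i * (x - y) $ i) = 0"
      by (simp add: inner_vec_def sum.remove[of _ i0])
    then have "\<bar>a $ i0\<bar> * \<bar>(x - y) $ i0\<bar> = \<bar>\<Sum>i\<in>UNIV - {i0}. a $ i * (x - y) $ i\<bar>"
      by (simp flip: abs_mult)
    also have "\<dots> \<le> (\<Sum>i\<in>UNIV - {i0}. \<bar>a $ i0\<bar> * (1 / d))"
    proof (rule order.trans[OF sum_abs], rule sum_mono)
      fix i assume "i \<in> UNIV - {i0}"
      then have "\<bar>a $ i\<bar> * \<bar>(x - y) $ i\<bar> \<le> \<bar>a $ i0\<bar> * (1 / d)"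
        unfolding vector_minus_component by (intro mult_mono[OF i0 c]) simp_all
      then show "\<bar>a $ i * (x - y) $ i\<bar> \<le> \<bar>a $ i0\<bar> * (1 / d)"
        unfolding abs_mult .
    qed
    also have "\<dots> \<le> \<bar>a $ i0\<bar> * 1"
      using d1 by (auto simp: d_def field_simps of_nat_diff)
    finally have "\<bar>(x - y) $ i0\<bar> \<le> 1" using a0 by simp
    moreover have "\<bar>(x - y) $ i\<bar> \<le> 1" if "i \<noteq> i0" for i
    proof -
      have "1 / d \<le> 1" using d1 by simp
      then show ?thesis using c[OF that] by simp
    qed
    ultimately show ?thesis unfolding infnorm_le_iff by metis
  qed
  define g :: "real ^ 'd \<Rightarrow> real ^ 'd" where
    "g x = (\<chi> i. if i = i0 then 0 else of_int \<lfloor>d * x $ i\<rfloor>)" for x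
  \<comment> \<open>The coordinate i0 is blanked out, so that the image has d - 1 free coordinates.\<close>
  define S where "S i = (if i = i0 then {0} else {z \<in> \<int>. - (d * r) - 1 \<le> z \<and> z \<le> d * r})" for i :: 'd
  have fibres: "card (box_points \<Lambda> r) \<le> card (g ` box_points \<Lambda> r) * card (box_points \<Lambda> 1)"
  proof (rule card_le_card_image_times[OF finite_box_points])
    fix z assume "z \<in> g ` box_points \<Lambda> r"
    then obtain y where y: "y \<in> box_points \<Lambda> r" "z = g y" by blast
    have "(\<lambda>x. x - y) ` {x \<in> box_points \<Lambda> r. g x = z} \<subseteq> box_points \<Lambda> 1"
    proof (clarsimp simp: y)
      fix x assume x: "x \<in> box_points \<Lambda> r" "g x = g y"
      have "\<bar>x $ i - y $ i\<bar> \<le> 1 / d" if "i \<noteq> i0" for i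
      proof -
        have "\<lfloor>d * x $ i\<rfloor> = \<lfloor>d * y $ i\<rfloor>"
          using arg_cong[OF x(2), of "\<lambda>v. v $ i"] that by (simp add: g_def)
        then have "\<bar>d * x $ i - d * y $ i\<bar> \<le> 1" by linarith
        then have "d * \<bar>x $ i - y $ i\<bar> \<le> 1"
          using d1 by (simp add: abs_mult flip: right_diff_distrib)
        then show ?thesis using d1 by (simp add: field_simps)
      qed
      then show "x - y \<in> box_points \<Lambda> 1" using diff x y by (auto simp: box_points_def diff_mem)
    qed
    then show "card {x \<in> box_points \<Lambda> r. g x = z} \<le> card (box_points \<Lambda> 1)"
      by (rule card_inj_on_le[rotated]) (auto simp: inj_on_def finite_box_points)
  qed
  have image: "real (card (g ` box_points \<Lambda> r)) \<le> (4 * d * r) ^ (CARD('d) - 1)"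
  proof -
    have finS: "finite (S i)" for i unfolding S_def by (simp add: finite_Ints_interval)
    have "g ` box_points \<Lambda> r \<subseteq> {x. \<forall>i. x $ i \<in> S i}"
    proof (clarsimp simp: S_def g_def)
      fix x i assume "x \<in> box_points \<Lambda> r"
      then have "\<bar>x $ i\<bar> \<le> r" by (auto simp: box_points_def infnorm_le_iff)
      then have "\<bar>d * x $ i\<bar> \<le> d * r" using d1 by (simp add: abs_mult)
      then show "- (d * r) - 1 \<le> of_int \<lfloor>d * x $ i\<rfloor> \<and> of_int \<lfloor>d * x $ i\<rfloor> \<le> d * r"
        by linarith
    qed
    then have "card (g ` box_points \<Lambda> r) \<le> card {x :: real ^ 'd. \<forall>i. x $ i \<in> S i}"
      by (rule card_mono[OF finite_vec_product[OF finS]])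
    also have "\<dots> = (\<Prod>i\<in>UNIV. card (S i))" by (rule card_vec_product[OF finS])
    also have "\<dots> = (\<Prod>i\<in>UNIV - {i0}. card (S i))"
      by (simp add: prod.remove[of _ i0] S_def)
    finally have "real (card (g ` box_points \<Lambda> r)) \<le> (\<Prod>i\<in>UNIV - {i0}. real (card (S i)))"
      by (simp flip: of_nat_prod)
    also have "\<dots> \<le> (\<Prod>i\<in>UNIV - {i0}. 4 * d * r)"
    proof (rule prod_mono, clarsimp simp: S_def)
      have "1 \<le> d * r" using d1 r by (metis mult_mono' mult_1 zero_le_one)
      then show "real (card {z \<in> \<int>. - (d * r) - 1 \<le> z \<and> z \<le> d * r}) \<le> 4 * d * r"
        using card_Ints_interval[of "- (d * r) - 1" "d * r"] by linarith
    qed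
    finally show ?thesis by simp
  qed
  have "real (card (box_points \<Lambda> r)) \<le> real (card (g ` box_points \<Lambda> r)) * real (card (box_points \<Lambda> 1))"
    using fibres by (simp flip: of_nat_mult)
  also have "\<dots> \<le> (4 * d * r) ^ (CARD('d) - 1) * card (box_points \<Lambda> 1)"
    by (intro mult_right_mono image) simp
  finally show ?thesis by (simp add: d_def)
qed

text \<open>Round the coefficients with respect to a basis of vectors from the box down to integers.\<close>

lemma covering_if_spanning:
  fixes r :: real
  assumes "span (box_points \<Lambda> r) = UNIV"
  shows "\<exists>x\<in>\<Lambda>. infnorm (z - x) \<le> CARD('d) * r"
proof -
  obtain B where B: "B \<subseteq> box_points \<Lambda> r" "independent B" "box_points \<Lambda> r \<subseteq> span B" "card B = dim (box_points \<Lambda> r)"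
    using basis_exists by blast
  have finB: "finite B" using B(2) finiteI_independent by blast
  have "span B = UNIV" using B(3) assms by (metis span_mono span_span top.extremum_uniqueI)
  then have "z \<in> span B" by simp
  then obtain u where u: "z = (\<Sum>b\<in>B. u b *\<^sub>R b)" unfolding span_finite[OF finB] by auto
  have cB: "card B = CARD('d)" using B(4) assms dim_eq_full[of "box_points \<Lambda> r"] by simp
  define x where "x = (\<Sum>b\<in>B. of_int \<lfloor>u b\<rfloor> *\<^sub>R b)"
  have "x \<in> \<Lambda>" unfolding x_def using B(1) by (intro sum_mem int_scale_mem) (auto simp: box_points_def)
  moreover have "z - x = (\<Sum>b\<in>B. frac (u b) *\<^sub>R b)"
    by (simp add: u x_def frac_def scaleR_diff_left sum_subtractf)
  moreover have "infnorm (\<Sum>b\<in>B. frac (u b) *\<^sub>R b) \<le> card B * r"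
  proof (unfold infnorm_le_iff, rule allI)
    fix i
    have "\<bar>(\<Sum>b\<in>B. frac (u b) *\<^sub>R b) $ i\<bar> \<le> (\<Sum>b\<in>B. r)"
    proof (simp only: sum_component, rule order.trans[OF sum_abs], rule sum_mono)
      fix b assume "b \<in> B"
      then have "\<bar>b $ i\<bar> \<le> r" using B(1) by (auto simp: box_points_def infnorm_le_iff)
      moreover have "\<bar>(frac (u b) *\<^sub>R b) $ i\<bar> \<le> 1 * \<bar>b $ i\<bar>"
        unfolding vector_scaleR_component real_scaleR_def abs_mult
        using frac_ge_0[of "u b"] frac_lt_1[of "u b"] by (intro mult_right_mono) simp_all
      ultimately show "\<bar>(frac (u b) *\<^sub>R b) $ i\<bar> \<le> r" by linarith
    qed
    then show "\<bar>(\<Sum>b\<in>B. frac (u b) *\<^sub>R b) $ i\<bar> \<le> card B * r" by simp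
  qed
  ultimately show ?thesis using cB by metis
qed

text \<open>The assumption \<open>bound\<close> expresses that the covolume is not too small. By the covering property lattice points can be
chosen near all the centres of a wide grid of cubes; the translates by these points of the lattice
points in the box are disjoint, and there are as many translates as cubes. Comparison with the known
count in a huge box gives the bound, since the number of cubes cancels.\<close>

lemma card_box_le_if_spanning:
  fixes r :: real
  assumes span: "span (box_points \<Lambda> r) = UNIV" and r: "0 < r" and d: "2 \<le> CARD('d)"
    and bound: "\<And>R. R0 \<le> R \<Longrightarrow> real (card (box_points \<Lambda> R)) \<le> (3 * R) ^ CARD('d)"
  shows "real (card (box_points \<Lambda> r)) \<le> (12 * CARD('d) * r) ^ CARD('d)"
proof -
  define d where "d = real CARD('d)"
  have d2: "d \<ge> 2" using d by (simp add: d_def)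
  obtain J :: nat where J: "max 0 (R0 / (4 * d * r)) < J"
    using reals_Archimedean2 by blast
  then have J: "R0 / (4 * d * r) < J" "0 < J" by simp_all
  have "\<exists>x\<in>\<Lambda>. infnorm (z - x) \<le> d * r" for z using covering_if_spanning[OF span] by (simp add: d_def)
  then obtain near where near: "\<And>z. near z \<in> \<Lambda>" "\<And>z. infnorm (z - near z) \<le> d * r" by metis
  define C where "C = {c :: nat ^ 'd. \<forall>i. c $ i \<in> {..<J}}"
  \<comment> \<open>Centres at distance 4dr, while the points attached to a centre lie within (d + 1)r of it; since
    2(d + 1) < 4d for d \<ge> 2, different centres do not interfere.\<close>
  define ctr where "ctr c = (\<chi> i. 4 * d * r * real (c $ i))" for c :: "nat ^ 'd"
  define F where "F = (\<lambda>(c, x). near (ctr c) + x)"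
  have cardC: "card C = J ^ CARD('d)" unfolding C_def by (subst card_vec_product) auto
  have close: "\<bar>ctr c $ i - (near (ctr c) + x) $ i\<bar> \<le> (d + 1) * r" if "x \<in> box_points \<Lambda> r" for c x i
  proof -
    have "\<bar>(ctr c - near (ctr c)) $ i\<bar> \<le> d * r" using near(2)[of "ctr c"] unfolding infnorm_le_iff by blast
    moreover have "\<bar>x $ i\<bar> \<le> r" using that by (auto simp: box_points_def infnorm_le_iff)
    ultimately show ?thesis by (simp add: algebra_simps)
  qed
  have "inj_on F (C \<times> box_points \<Lambda> r)"
  proof (rule inj_onI, clarsimp simp: F_def)
    fix c x c' x'
    assume *: "x \<in> box_points \<Lambda> r" "x' \<in> box_points \<Lambda> r" "near (ctr c) + x = near (ctr c') + x'"
    have "c = c'"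
    proof (rule ccontr)
      assume "c \<noteq> c'"
      then obtain i where i: "c $ i \<noteq> c' $ i" by (auto simp: vec_eq_iff)
      have "\<bar>ctr c $ i - ctr c' $ i\<bar> \<le> 2 * ((d + 1) * r)"
        using close[OF *(1), of c i] close[OF *(2), of c' i] unfolding *(3) by linarith
      moreover have "\<bar>ctr c $ i - ctr c' $ i\<bar> = 4 * d * r * \<bar>real (c $ i) - real (c' $ i)\<bar>"
        using d2 r by (simp add: ctr_def abs_mult flip: right_diff_distrib)
      moreover have "4 * d * r * 1 \<le> 4 * d * r * \<bar>real (c $ i) - real (c' $ i)\<bar>"
        using d2 r i by (intro mult_left_mono) auto
      moreover have "2 * r \<le> d * r" using d2 r by simp
      ultimately show False using r by (simp add: algebra_simps)
    qed
    then show "c = c' \<and> x = x'" using * by simp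
  qed
  moreover have "F ` (C \<times> box_points \<Lambda> r) \<subseteq> box_points \<Lambda> (4 * d * r * J)"
  proof (clarsimp simp: F_def)
    fix c x assume *: "c \<in> C" "x \<in> box_points \<Lambda> r"
    have "\<bar>(near (ctr c) + x) $ i\<bar> \<le> 4 * d * r * J" for i
    proof -
      have "c $ i < J" using * by (simp add: C_def)
      then have "real (c $ i) + 1 \<le> real J" by linarith
      then have "4 * d * r * (real (c $ i) + 1) \<le> 4 * d * r * J"
        using d2 r by (intro mult_left_mono) auto
      moreover have "\<bar>ctr c $ i\<bar> = 4 * d * r * real (c $ i)" using d2 r by (simp add: ctr_def)
      moreover have "(d + 1) * r \<le> 4 * d * r" using d2 r by simp
      ultimately show ?thesis using close[OF *(2), of c i] by (simp add: algebra_simps)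
    qed
    then show "near (ctr c) + x \<in> box_points \<Lambda> (4 * d * r * J)"
      using * near(1) by (auto simp: box_points_def infnorm_le_iff add_mem)
  qed
  ultimately have "card (C \<times> box_points \<Lambda> r) \<le> card (box_points \<Lambda> (4 * d * r * J))"
    using card_inj_on_le finite_box_points by blast
  then have "real (card (C \<times> box_points \<Lambda> r)) \<le> (3 * (4 * d * r * J)) ^ CARD('d)"
    using bound[of "4 * d * r * J"] J d2 r by (simp add: field_simps)
  then have "real J ^ CARD('d) * real (card (box_points \<Lambda> r)) \<le> real J ^ CARD('d) * (12 * d * r) ^ CARD('d)"
    by (simp add: card_cartesian_product cardC power_mult_distrib[symmetric] mult_ac)
  then show ?thesis using J(2) by (simp add: d_def)
qed

end

section \<open>The lattice of a matrix at a given scale\<close>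

lemma int_lattice_iff: "p \<in> int_lattice \<longleftrightarrow> (\<forall>i. p $ i \<in> \<int>)"
  by (simp add: int_lattice_def)

lemma int_lattice_diff: "p \<in> int_lattice \<Longrightarrow> q \<in> int_lattice \<Longrightarrow> p - q \<in> int_lattice"
  by (simp add: int_lattice_def)

text \<open>For unipotent \<open>u\<^sub>A\<close> and the diagonal flow \<open>g\<^sub>t\<close> this is the vector \<open>g\<^sub>t u\<^sub>A (-p, q)\<close> of homogeneous
dynamics. The exponents make the flow volume preserving.\<close>

definition flow_vec :: "real \<Rightarrow> real ^ 'n ^ 'm \<Rightarrow> real ^ 'm \<Rightarrow> real ^ 'n \<Rightarrow> real ^ ('m + 'n)" where
  "flow_vec t A p q = (\<chi> i. case i of Inl i \<Rightarrow> t ^ CARD('n) * (A *v q - p) $ i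
                              | Inr j \<Rightarrow> q $ j / t ^ CARD('m))"

definition flow_lattice :: "real \<Rightarrow> real ^ 'n ^ 'm \<Rightarrow> (real ^ ('m + 'n)) set" where
  "flow_lattice t A = {flow_vec t A p q | p q. p \<in> int_lattice \<and> q \<in> int_lattice}"

lemma card_sum_type: "CARD('m::finite + 'n::finite) = CARD('m) + CARD('n)"
  by (simp add: card_UNIV_sum)

lemma flow_vec_Inl [simp]: "flow_vec t A p q $ Inl i = t ^ CARD('n) * ((A *v q) $ i - p $ i)"
  for A :: "real ^ 'n ^ 'm"
  by (simp add: flow_vec_def)

lemma flow_vec_Inr [simp]: "flow_vec t A p q $ Inr j = q $ j / t ^ CARD('m)"
  for A :: "real ^ 'n ^ 'm"
  by (simp add: flow_vec_def)

lemma all_sum_type: "(\<forall>i. P i) \<longleftrightarrow> (\<forall>i. P (Inl i)) \<and> (\<forall>j. P (Inr j))" for P :: "'a + 'b \<Rightarrow> bool"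
  by (metis sum.exhaust)

lemma infnorm_flow_vec_le_iff:
  fixes A :: "real ^ 'n ^ 'm" and r :: real
  assumes "t > 0"
  shows "infnorm (flow_vec t A p q) \<le> r \<longleftrightarrow>
    (\<forall>i. t ^ CARD('n) * \<bar>(A *v q) $ i - p $ i\<bar> \<le> r) \<and> (\<forall>j. \<bar>q $ j\<bar> \<le> r * t ^ CARD('m))"
  using assms by (simp add: infnorm_le_iff all_sum_type abs_mult divide_le_eq)

lemma flow_vec_diff: "flow_vec t A p q - flow_vec t A p' q' = flow_vec t A (p - p') (q - q')"
  by (simp add: vec_eq_iff all_sum_type matrix_vector_mult_diff_distrib algebra_simps diff_divide_distrib)

lemma flow_vec_inject:
  assumes "t > 0"
  shows "flow_vec t A p q = flow_vec t A p' q' \<longleftrightarrow> p = p' \<and> q = q'"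
proof
  assume *: "flow_vec t A p q = flow_vec t A p' q'"
  have "q $ j = q' $ j" for j
    using arg_cong[OF *, of "\<lambda>v. v $ Inr j"] assms by simp
  then have q: "q = q'" by (simp add: vec_eq_iff)
  have "p $ i = p' $ i" for i
    using arg_cong[OF *, of "\<lambda>v. v $ Inl i"] assms q by simp
  with q show "p = p' \<and> q = q'" by (simp add: vec_eq_iff)
qed simp

definition near_pairs :: "real \<Rightarrow> real ^ 'n ^ 'm \<Rightarrow> real \<Rightarrow> ((real ^ 'm) \<times> (real ^ 'n)) set" where
  "near_pairs t A r = {(p, q). p \<in> int_lattice \<and> q \<in> int_lattice \<and> infnorm (flow_vec t A p q) \<le> r}"

lemma box_points_flow_lattice: "box_points (flow_lattice t A) r = (\<lambda>(p, q). flow_vec t A p q) ` near_pairs t A r"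
  by (force simp: box_points_def flow_lattice_def near_pairs_def)

lemma card_box_points_flow_lattice: "t > 0 \<Longrightarrow> card (box_points (flow_lattice t A) r) = card (near_pairs t A r)"
  unfolding box_points_flow_lattice by (intro card_image) (auto simp: inj_on_def flow_vec_inject)

text \<open>In a large box both the number of q and, for each q, the number of p are comparable to the lengths of
the intervals in which the coordinates vary.\<close>

lemma near_pairs_bound:
  fixes A :: "real ^ 'n ^ 'm" and r :: real
  assumes t: "t > 0"
  shows finite_near_pairs: "finite (near_pairs t A r)"
    and card_near_pairs_large: "max (t ^ CARD('n)) (1 / t ^ CARD('m)) \<le> r \<Longrightarrow>
      real (card (near_pairs t A r)) \<le> (3 * r) ^ CARD('m + 'n)"
proof -
  define X where "X = r * t ^ CARD('m)"
  define Y where "Y = r / t ^ CARD('n)"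
  define Sq where "Sq = {z \<in> \<int>. - X \<le> z \<and> z \<le> X}"
  define Sp where "Sp q i = {z \<in> \<int>. (A *v q) $ i - Y \<le> z \<and> z \<le> (A *v q) $ i + Y}" for q i
  define Q where "Q = {q :: real ^ 'n. \<forall>j. q $ j \<in> Sq}"
  define P where "P q = {p :: real ^ 'm. \<forall>i. p $ i \<in> Sp q i}" for q
  have fin: "finite Q" "finite (P q)" for q
    unfolding Q_def P_def Sq_def Sp_def by (intro finite_vec_product finite_Ints_interval)+
  have sub: "near_pairs t A r \<subseteq> (\<lambda>(q, p). (p, q)) ` Sigma Q P"
  proof clarify
    fix p q assume "(p, q) \<in> near_pairs t A r"
    then have *: "p \<in> int_lattice" "q \<in> int_lattice"
      "t ^ CARD('n) * \<bar>(A *v q) $ i - p $ i\<bar> \<le> r" "\<bar>q $ j\<bar> \<le> X" for i j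
      using t by (auto simp: near_pairs_def infnorm_flow_vec_le_iff X_def)
    have "\<bar>(A *v q) $ i - p $ i\<bar> \<le> Y" for i
      using *(3)[of i] t by (simp add: Y_def field_simps)
    then have "p \<in> P q" using *(1) by (auto simp: P_def Sp_def int_lattice_iff abs_le_iff algebra_simps)
    moreover have "q \<in> Q" using *(2,4) by (auto simp: Q_def Sq_def int_lattice_iff abs_le_iff minus_le_iff)
    ultimately show "(p, q) \<in> (\<lambda>(q, p). (p, q)) ` Sigma Q P" by auto
  qed
  then show "finite (near_pairs t A r)" 
    by (rule finite_subset) (intro finite_imageI finite_SigmaI fin)
  assume "max (t ^ CARD('n)) (1 / t ^ CARD('m)) \<le> r"
  then have XY: "1 \<le> X" "1 \<le> Y" using t by (auto simp: X_def Y_def field_simps)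
  have "card (near_pairs t A r) \<le> card (Sigma Q P)"
    using surj_card_le[OF finite_SigmaI[OF fin] sub] .
  also have "\<dots> = (\<Sum>q\<in>Q. card (P q))" using fin by (simp add: card_SigmaI)
  finally have "real (card (near_pairs t A r)) \<le> (\<Sum>q\<in>Q. real (card (P q)))"
    by (simp flip: of_nat_sum)
  also have "\<dots> \<le> (\<Sum>q\<in>Q. (3 * Y) ^ CARD('m))"
  proof (rule sum_mono)
    fix q
    have "real (card (P q)) = (\<Prod>i\<in>UNIV. real (card (Sp q i)))"
      unfolding P_def Sp_def by (subst card_vec_product) (auto simp: finite_Ints_interval)
    also have "\<dots> \<le> (\<Prod>i\<in>(UNIV::'m set). 3 * Y)"
    proof (rule prod_mono, safe)
      fix i
      show "real (card (Sp q i)) \<le> 3 * Y"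
        using card_Ints_interval[of "(A *v q) $ i - Y" "(A *v q) $ i + Y"] XY unfolding Sp_def by linarith
    qed simp
    finally show "real (card (P q)) \<le> (3 * Y) ^ CARD('m)" by simp
  qed
  also have "\<dots> = real (card Q) * (3 * Y) ^ CARD('m)" by simp
  also have "\<dots> \<le> (3 * X) ^ CARD('n) * (3 * Y) ^ CARD('m)"
  proof (rule mult_right_mono)
    have "real (card Q) = (\<Prod>i\<in>(UNIV::'n set). real (card Sq))"
      unfolding Q_def Sq_def by (subst card_vec_product) (auto simp: finite_Ints_interval)
    also have "\<dots> \<le> (\<Prod>i\<in>(UNIV::'n set). 3 * X)"
      using card_Ints_interval[of "- X" "X"] XY unfolding Sq_def by (intro prod_mono) auto
    finally show "real (card Q) \<le> (3 * X) ^ CARD('n)" by simp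
  qed (use XY in auto)
  also have "\<dots> = (3 * r) ^ CARD('m + 'n)"
    using t by (simp add: X_def Y_def card_sum_type power_add power_mult_distrib power_divide
        mult.commute flip: power_mult)
  finally show "real (card (near_pairs t A r)) \<le> (3 * r) ^ CARD('m + 'n)" .
qed

lemma discrete_subgroup_flow_lattice:
  assumes "t > 0"
  shows "discrete_subgroup (flow_lattice t A)"
proof
  show "0 \<in> flow_lattice t A"
    unfolding flow_lattice_def by (auto simp: vec_eq_iff all_sum_type int_lattice_def intro!: exI[of _ 0])
  show "finite (box_points (flow_lattice t A) r)" for r
    unfolding box_points_flow_lattice using finite_near_pairs[OF assms] by blast
  show "x - y \<in> flow_lattice t A" if "x \<in> flow_lattice t A" "y \<in> flow_lattice t A" for x y
    using that unfolding flow_lattice_def by (auto simp: flow_vec_diff) (metis int_lattice_diff)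
qed

text \<open>Pigeonhole as in the proof of Dirichlet's theorem: the fractional parts of A q, for q in a cube, are
distributed among cells of side at most \<open>r / t\<^sup>n\<close>, and the differences of the q in a common cell give
lattice vectors in the box. The condition \<open>r \<le> t\<^sup>n\<close> makes rounding up the number of cells harmless.\<close>

lemma card_box_ge:
  fixes A :: "real ^ 'n ^ 'm" and r :: real
  assumes t: "t > 0" and r: "0 < r" "r \<le> t ^ CARD('n)"
  shows "r ^ CARD('m + 'n) / 2 ^ CARD('m) \<le> real (card (box_points (flow_lattice t A) r))"
proof -
  define X where "X = nat \<lfloor>r * t ^ CARD('m)\<rfloor>"
  define K where "K = nat \<lceil>t ^ CARD('n) / r\<rceil>"
  have X: "real X \<le> r * t ^ CARD('m)" "r * t ^ CARD('m) \<le> real (X + 1)"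
    using t r by (auto simp: X_def) linarith+
  have K: "t ^ CARD('n) / r \<le> real K" "real K \<le> 2 * t ^ CARD('n) / r" "1 \<le> K"
  proof -
    have "1 \<le> t ^ CARD('n) / r" using t r by simp
    then show "t ^ CARD('n) / r \<le> real K" "real K \<le> 2 * t ^ CARD('n) / r" "1 \<le> K"
      unfolding K_def by linarith+
  qed
  define emb where "emb x = (\<chi> j. real (x $ j))" for x :: "nat ^ 'n"
  define D where "D = {x :: nat ^ 'n. \<forall>j. x $ j \<in> {..X}}"
  define g where "g x = (\<chi> i. nat \<lfloor>real K * frac ((A *v emb x) $ i)\<rfloor>)" for x
  have finD: "finite D" unfolding D_def by (intro finite_vec_product) simp
  have cardD: "real (card D) = real (X + 1) ^ CARD('n)"
    unfolding D_def by (subst card_vec_product) auto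
  have "g ` D \<subseteq> {y. \<forall>i. y $ i \<in> {..<K}}"
  proof (clarsimp simp: g_def)
    fix x i
    have "real K * frac ((A *v emb x) $ i) < real K * 1"
      using K(3) by (intro mult_strict_left_mono frac_lt_1) auto
    then show "nat \<lfloor>real K * frac ((A *v emb x) $ i)\<rfloor> < K"
      using K(3) by (simp add: floor_less_iff nat_less_iff)
  qed
  then have "card (g ` D) \<le> card {y :: nat ^ 'm. \<forall>i. y $ i \<in> {..<K}}"
    by (intro card_mono finite_vec_product) auto
  then have image: "card (g ` D) \<le> K ^ CARD('m)"
    by (subst (asm) card_vec_product) auto
  have "card D \<le> card (g ` D) * card (box_points (flow_lattice t A) r)"
  proof (rule card_le_card_image_times[OF finD])
    fix y assume "y \<in> g ` D"
    then obtain x0 where x0: "x0 \<in> D" "y = g x0" by blast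
    \<comment> \<open>The integer parts of A x; they turn differences of fractional parts into lattice vectors.\<close>
    define fl where "fl x = (\<chi> i. real_of_int \<lfloor>(A *v emb x) $ i\<rfloor>)" for x
    define F where "F x = flow_vec t A (fl x - fl x0) (emb x - emb x0)" for x
    have "inj_on F {x \<in> D. g x = y}"
    proof (rule inj_onI)
      fix x x' assume "F x = F x'"
      then have "emb x = emb x'" using t by (simp add: F_def flow_vec_inject)
      then show "x = x'" by (simp add: emb_def vec_eq_iff)
    qed
    moreover have "F ` {x \<in> D. g x = y} \<subseteq> box_points (flow_lattice t A) r"
    proof (clarsimp simp: x0(2))
      fix x assume x: "x \<in> D" "g x = g x0"
      have mem: "F x \<in> flow_lattice t A"
        unfolding flow_lattice_def F_def by (auto simp: int_lattice_def fl_def emb_def intro!: exI)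
      have "t ^ CARD('n) * \<bar>(A *v (emb x - emb x0)) $ i - (fl x - fl x0) $ i\<bar> \<le> r" for i
      proof -
        have "nat \<lfloor>real K * frac ((A *v emb x) $ i)\<rfloor> = nat \<lfloor>real K * frac ((A *v emb x0) $ i)\<rfloor>"
          using arg_cong[OF x(2), of "\<lambda>v. v $ i"] by (simp add: g_def)
        then have "\<lfloor>real K * frac ((A *v emb x) $ i)\<rfloor> = \<lfloor>real K * frac ((A *v emb x0) $ i)\<rfloor>"
          by (simp add: nat_eq_iff frac_ge_0 split: if_splits)
        then have "\<bar>real K * frac ((A *v emb x) $ i) - real K * frac ((A *v emb x0) $ i)\<bar> \<le> 1"
          by linarith
        then have "real K * \<bar>frac ((A *v emb x) $ i) - frac ((A *v emb x0) $ i)\<bar> \<le> 1"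
          by (simp add: abs_mult flip: right_diff_distrib)
        moreover have "t ^ CARD('n) / r * \<bar>frac ((A *v emb x) $ i) - frac ((A *v emb x0) $ i)\<bar>
            \<le> real K * \<bar>frac ((A *v emb x) $ i) - frac ((A *v emb x0) $ i)\<bar>"
          by (intro mult_right_mono K) simp
        ultimately have "t ^ CARD('n) / r * \<bar>frac ((A *v emb x) $ i) - frac ((A *v emb x0) $ i)\<bar> \<le> 1"
          by linarith
        then show ?thesis
          using r by (simp add: field_simps frac_def fl_def matrix_vector_mult_diff_distrib)
      qed
      moreover have "\<bar>(emb x - emb x0) $ j\<bar> \<le> r * t ^ CARD('m)" for j
      proof -
        have "x $ j \<le> X" "x0 $ j \<le> X" using x x0 by (auto simp: D_def)
        then show ?thesis using X(1) by (auto simp: emb_def abs_le_iff)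
      qed
      ultimately show "F x \<in> box_points (flow_lattice t A) r"
        using mem t by (simp add: box_points_def F_def infnorm_flow_vec_le_iff)
    qed
    ultimately show "card {x \<in> D. g x = y} \<le> card (box_points (flow_lattice t A) r)"
      using card_inj_on_le discrete_subgroup.finite_box_points[OF discrete_subgroup_flow_lattice[OF t]] by blast
  qed
  also have "\<dots> \<le> K ^ CARD('m) * card (box_points (flow_lattice t A) r)"
    by (intro mult_right_mono image) simp
  finally have "real (card D) \<le> real K ^ CARD('m) * card (box_points (flow_lattice t A) r)"
    by (simp flip: of_nat_mult of_nat_power)
  moreover have "(r * t ^ CARD('m)) ^ CARD('n) \<le> real (card D)"
    unfolding cardD using t r X by (intro power_mono) auto
  moreover have "real K ^ CARD('m) * card (box_points (flow_lattice t A) r) \<le>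
      (2 * t ^ CARD('n) / r) ^ CARD('m) * card (box_points (flow_lattice t A) r)"
    by (intro mult_right_mono power_mono K) auto
  ultimately have "(r * t ^ CARD('m)) ^ CARD('n) \<le>
      (2 * t ^ CARD('n) / r) ^ CARD('m) * card (box_points (flow_lattice t A) r)" by linarith
  then have "t ^ (CARD('m) * CARD('n)) * (r ^ CARD('n) * r ^ CARD('m)) \<le>
      t ^ (CARD('m) * CARD('n)) * (2 ^ CARD('m) * card (box_points (flow_lattice t A) r))"
    using r by (simp add: power_mult_distrib power_divide field_simps flip: power_mult)
  then show ?thesis
    using t by (simp add: card_sum_type power_add field_simps)
qed

lemma two_le_card_sum_type: "2 \<le> CARD('m::finite + 'n::finite)"
  using zero_less_card_finite[where ?'a='m] zero_less_card_finite[where ?'a='n]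
  unfolding card_sum_type by linarith

lemma card_flow_box_le_if_spanning:
  fixes A :: "real ^ 'n ^ 'm" and r :: real
  assumes t: "t > 0" and r: "0 < r" and "span (box_points (flow_lattice t A) r) = UNIV"
  shows "real (card (box_points (flow_lattice t A) r)) \<le> (12 * CARD('m + 'n) * r) ^ CARD('m + 'n)"
proof -
  have "real (card (box_points (flow_lattice t A) R)) \<le> (3 * R) ^ CARD('m + 'n)"
    if "max (t ^ CARD('n)) (1 / t ^ CARD('m)) \<le> R" for R
    using card_near_pairs_large[OF t that] card_box_points_flow_lattice[OF t, of A] by simp
  from discrete_subgroup.card_box_le_if_spanning[OF discrete_subgroup_flow_lattice[OF t] assms(3) r two_le_card_sum_type this]
  show ?thesis .
qed

section \<open>Subdivision of cells\<close>

definition grid :: "nat \<Rightarrow> (nat ^ 'n ^ 'm) set" where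
  "grid N = {L. \<forall>i j. L $ i $ j < N}"

text \<open>A cell is represented by its corner with the smallest entries; the corners of its subcells are obtained
by adding grid points, scaled by the new side length.\<close>

definition corner :: "real \<Rightarrow> real ^ 'n ^ 'm \<Rightarrow> nat ^ 'n ^ 'm \<Rightarrow> real ^ 'n ^ 'm" where
  "corner r A L = (\<chi> i j. A $ i $ j + r * real (L $ i $ j))"

lemma grid_eq: "grid N = {L. \<forall>i. L $ i \<in> {x. \<forall>j. x $ j \<in> {..<N}}}"
  by (auto simp: grid_def)

lemma grid_finite_card:
  shows finite_grid: "finite (grid N :: (nat ^ 'n ^ 'm) set)"
    and card_grid: "card (grid N :: (nat ^ 'n ^ 'm) set) = N ^ (CARD('m) * CARD('n))"
proof -
  have fin: "finite {x :: nat ^ 'n. \<forall>j. x $ j \<in> {..<N}}" by (rule finite_vec_product) simp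
  have "card {x :: nat ^ 'n. \<forall>j. x $ j \<in> {..<N}} = N ^ CARD('n)"
    by (subst card_vec_product) auto
  then show "card (grid N :: (nat ^ 'n ^ 'm) set) = N ^ (CARD('m) * CARD('n))"
    unfolding grid_eq card_vec_product[OF fin] by (simp add: mult.commute flip: power_mult)
  show "finite (grid N :: (nat ^ 'n ^ 'm) set)"
    unfolding grid_eq by (rule finite_vec_product[OF fin])
qed

lemma card_progression_le:
  fixes c \<delta> w :: real
  assumes "\<delta> \<noteq> 0" "0 \<le> w"
  shows "finite {l :: nat. \<bar>c + \<delta> * real l\<bar> \<le> w}"
    and "real (card {l :: nat. \<bar>c + \<delta> * real l\<bar> \<le> w}) \<le> 2 * w / \<bar>\<delta>\<bar> + 1"
proof -
  define e where "e = \<bar>\<delta>\<bar>"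
  define c' where "c' = sgn \<delta> * c"
  have e: "e > 0" using assms by (simp add: e_def)
  have abs: "\<bar>c + \<delta> * x\<bar> = \<bar>c' + e * x\<bar>" for x
    using assms(1) by (cases "\<delta> > 0") (auto simp: e_def c'_def sgn_if)
  define I where "I = {z \<in> \<int>. (- w - c') / e \<le> z \<and> z \<le> (w - c') / e}"
  have sub: "real ` {l :: nat. \<bar>c + \<delta> * real l\<bar> \<le> w} \<subseteq> I"
    unfolding abs I_def using e by (auto simp: abs_le_iff field_simps)
  have finI: "finite I" unfolding I_def by (rule finite_Ints_interval)
  have inj: "inj_on real {l :: nat. \<bar>c + \<delta> * real l\<bar> \<le> w}" by (simp add: inj_on_def)
  show fin: "finite {l :: nat. \<bar>c + \<delta> * real l\<bar> \<le> w}"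
    using inj_on_finite[OF inj sub finI] .
  have "(- w - c') / e \<le> (w - c') / e" using assms e by (intro divide_right_mono) auto
  then have "real (card I) \<le> (w - c') / e - (- w - c') / e + 1"
    unfolding I_def by (intro card_Ints_interval) linarith
  also have "\<dots> = 2 * w / e + 1" using e by (simp add: field_simps)
  finally have "real (card I) \<le> 2 * w / e + 1" .
  then show "real (card {l :: nat. \<bar>c + \<delta> * real l\<bar> \<le> w}) \<le> 2 * w / \<bar>\<delta>\<bar> + 1"
    using card_inj_on_le[OF inj sub finI] by (simp add: e_def)
qed

text \<open>Fix all entries of the row but the one that multiplies a nonzero coordinate of q: the remaining entry runs
through an arithmetic progression that has to meet an interval.\<close>

lemma row_count:
  fixes q :: "real ^ 'n" and c r w :: real
  assumes q: "q $ j0 \<noteq> 0" and r: "r > 0" and w: "0 \<le> w"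
  shows "real (card {x :: nat ^ 'n. (\<forall>j. x $ j < N) \<and> \<bar>c + r * (\<Sum>j\<in>UNIV. real (x $ j) * q $ j)\<bar> \<le> w})
           \<le> real N ^ (CARD('n) - 1) * (2 * w / (r * \<bar>q $ j0\<bar>) + 1)"
proof -
  define X where "X = {x :: nat ^ 'n. (\<forall>j. x $ j < N) \<and> \<bar>c + r * (\<Sum>j\<in>UNIV. real (x $ j) * q $ j)\<bar> \<le> w}"
  define f where "f x = (\<chi> j. if j = j0 then 0 else x $ j)" for x :: "nat ^ 'n"
  define S where "S j = (if j = j0 then {0} else {..<N})" for j
  define B where "B = 2 * w / (r * \<bar>q $ j0\<bar>) + 1"
  have B: "B \<ge> 0" using r w by (simp add: B_def)
  have "X \<subseteq> {x. \<forall>j. x $ j < N}" by (auto simp: X_def)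
  then have finX: "finite X" by (rule finite_subset) (rule finite_vec_less)
  have "card X \<le> card (f ` X) * nat \<lfloor>B\<rfloor>"
  proof (rule card_le_card_image_times[OF finX])
    fix y assume "y \<in> f ` X"
    define s where "s = c + r * (\<Sum>j\<in>UNIV - {j0}. real (y $ j) * q $ j)"
    define P where "P = {l :: nat. \<bar>s + (r * q $ j0) * real l\<bar> \<le> w}"
    have P: "finite P" "real (card P) \<le> B"
      unfolding P_def B_def using card_progression_le[of "r * q $ j0" w s] q r w by (auto simp: abs_mult)
    have "inj_on (\<lambda>x. x $ j0) {x \<in> X. f x = y}"
    proof (rule inj_onI)
      fix x x' assume *: "x \<in> {x \<in> X. f x = y}" "x' \<in> {x \<in> X. f x = y}" "x $ j0 = x' $ j0"
      then have "f x = f x'" by simp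
      then have "x $ j = x' $ j" for j
        using *(3) by (auto simp: f_def vec_eq_iff split: if_splits)
      then show "x = x'" by (simp add: vec_eq_iff)
    qed
    moreover have "(\<lambda>x. x $ j0) ` {x \<in> X. f x = y} \<subseteq> P"
    proof clarify
      fix x assume x: "x \<in> X" "y = f x"
      have "(\<Sum>j\<in>UNIV. real (x $ j) * q $ j) = real (x $ j0) * q $ j0 + (\<Sum>j\<in>UNIV - {j0}. real (y $ j) * q $ j)"
        by (subst sum.remove[of _ j0]) (auto simp: x(2) f_def intro!: sum.cong)
      then have "c + r * (\<Sum>j\<in>UNIV. real (x $ j) * q $ j) = s + (r * q $ j0) * real (x $ j0)"
        by (simp add: s_def algebra_simps)
      then show "x $ j0 \<in> P" using x(1) by (simp add: X_def P_def)
    qed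
    ultimately have "card {x \<in> X. f x = y} \<le> card P" using P(1) card_inj_on_le by blast
    also have "card P \<le> nat \<lfloor>B\<rfloor>" using P(2) by (simp add: le_nat_floor)
    finally show "card {x \<in> X. f x = y} \<le> nat \<lfloor>B\<rfloor>" .
  qed
  moreover have "card (f ` X) \<le> N ^ (CARD('n) - 1)"
  proof -
    have finS: "finite (S j)" for j by (simp add: S_def)
    have "f ` X \<subseteq> {x. \<forall>j. x $ j \<in> S j}" by (auto simp: f_def S_def X_def)
    then have "card (f ` X) \<le> card {x :: nat ^ 'n. \<forall>j. x $ j \<in> S j}"
      by (rule card_mono[OF finite_vec_product[OF finS]])
    also have "\<dots> = (\<Prod>j\<in>UNIV - {j0}. card (S j))"
      unfolding card_vec_product[OF finS] by (simp add: prod.remove[of _ j0] S_def)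
    also have "\<dots> = (\<Prod>j\<in>UNIV - {j0}. N)" by (rule prod.cong) (auto simp: S_def)
    finally show ?thesis by (simp add: card_Diff_singleton)
  qed
  ultimately have "card X \<le> N ^ (CARD('n) - 1) * nat \<lfloor>B\<rfloor>"
    by (meson le_trans mult_le_mono1)
  then have "real (card X) \<le> real N ^ (CARD('n) - 1) * real (nat \<lfloor>B\<rfloor>)"
    by (simp flip: of_nat_mult of_nat_power)
  also have "\<dots> \<le> real N ^ (CARD('n) - 1) * B"
    using B by (intro mult_left_mono) auto
  finally show ?thesis by (simp add: X_def B_def)
qed

lemma corner_mult:
  "(corner r A L *v q) $ i = (A *v q) $ i + r * (\<Sum>j\<in>UNIV. real (L $ i $ j) * q $ j)"
  by (simp add: corner_def matrix_vector_mult_def distrib_right sum.distrib sum_distrib_left mult.assoc)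

text \<open>The proportion of subcells whose lattices contain the vector with label (p, q) in their unit box. The rows
of L can be chosen independently, and by \<open>row_count\<close> each of them contributes one factor. Since
\<open>\<bar>q\<bar> \<le> (t T)\<^sup>m\<close> may be assumed, the additive constant 1 there is absorbed into the factor 3.\<close>

lemma child_count:
  fixes A :: "real ^ 'n ^ 'm" and t :: real and p q
  defines "d \<equiv> CARD('m + 'n)"
  assumes t: "t > 0" and T: "1 \<le> T" and q: "0 < u" "u < infnorm q"
  shows "real (card {L \<in> grid (T ^ d). infnorm (flow_vec (t * T) (corner (1 / (t * T) ^ d) A L) p q) \<le> 1})
    \<le> real (card (grid (T ^ d) :: (nat ^ 'n ^ 'm) set)) * (3 * t ^ CARD('m) / (T ^ CARD('n) * u)) ^ CARD('m)"
proof -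
  define m n where "m = CARD('m)" and "n = CARD('n)"
  have d: "d = m + n" by (simp add: d_def m_def n_def card_sum_type)
  have n1: "n \<ge> 1" by (simp add: n_def Suc_leI)
  define t' where "t' = t * T"
  have t': "t' > 0" using t T by (simp add: t'_def)
  define N where "N = T ^ d"
  define r where "r = 1 / t' ^ d"
  have r: "r > 0" using t' by (simp add: r_def)
  define Z where "Z = {L \<in> grid N. infnorm (flow_vec t' (corner r A L) p q) \<le> 1}"
  obtain j0 where j0: "u < \<bar>q $ j0\<bar>" using q(2) infnorm_le_iff[of q u] by (auto simp: not_le)
  have "real (card Z) \<le> real (N ^ (m * n)) * (3 * t ^ m / (T ^ n * u)) ^ m"
  proof (cases "Z = {}")
    case True
    then show ?thesis using t q(1) by simp
  next
    case False
    then have q0: "\<bar>q $ j0\<bar> \<le> t' ^ m" using t' by (auto simp: Z_def infnorm_flow_vec_le_iff m_def)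
    define R where "R i = {x :: nat ^ 'n. (\<forall>j. x $ j < N) \<and>
      \<bar>((A *v q) $ i - p $ i) + r * (\<Sum>j\<in>UNIV. real (x $ j) * q $ j)\<bar> \<le> 1 / t' ^ n}" for i
    have "R i \<subseteq> {x. \<forall>j. x $ j < N}" for i by (auto simp: R_def)
    then have finR: "finite (R i)" for i by (rule finite_subset) (rule finite_vec_less)
    have "Z \<subseteq> {L. \<forall>i. L $ i \<in> R i}"
    proof clarify
      fix L i assume "L \<in> Z"
      then have L: "\<And>j. L $ i $ j < N" "t' ^ n * \<bar>(corner r A L *v q) $ i - p $ i\<bar> \<le> 1"
        using t' by (auto simp: Z_def grid_def infnorm_flow_vec_le_iff n_def)
      have "\<bar>(corner r A L *v q) $ i - p $ i\<bar> \<le> 1 / t' ^ n" using L(2) t' by (simp add: field_simps)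
      then show "L $ i \<in> R i" using L(1) unfolding corner_mult R_def by (simp add: algebra_simps)
    qed
    from card_mono[OF finite_vec_product[OF finR] this]
    have "card Z \<le> (\<Prod>i\<in>UNIV. card (R i))"
      unfolding card_vec_product[OF finR] .
    then have "real (card Z) \<le> (\<Prod>i\<in>UNIV. real (card (R i)))" by (simp flip: of_nat_prod)
    also have "\<dots> \<le> (\<Prod>i\<in>(UNIV::'m set). real N ^ (n - 1) * (3 * t' ^ m / u))"
    proof (rule prod_mono, safe)
      fix i
      have "real (card (R i)) \<le> real N ^ (n - 1) * (2 * (1 / t' ^ n) / (r * \<bar>q $ j0\<bar>) + 1)"
        unfolding R_def n_def using j0 q(1) r t' by (intro row_count) auto
      also have "\<dots> \<le> real N ^ (n - 1) * (3 * t' ^ m / u)"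
      proof (rule mult_left_mono)
        have "2 * (1 / t' ^ n) / (r * \<bar>q $ j0\<bar>) = 2 * (t' ^ m / \<bar>q $ j0\<bar>)"
          using t' j0 q(1) by (simp add: r_def d power_add field_simps)
        also have "\<dots> \<le> 2 * (t' ^ m / u)" using t' j0 q(1) by (intro mult_left_mono divide_left_mono) auto
        finally have "2 * (1 / t' ^ n) / (r * \<bar>q $ j0\<bar>) \<le> 2 * (t' ^ m / u)" .
        moreover have "1 \<le> t' ^ m / u" using j0 q0 q(1) by simp
        ultimately show "2 * (1 / t' ^ n) / (r * \<bar>q $ j0\<bar>) + 1 \<le> 3 * t' ^ m / u" by simp
      qed simp
      finally show "real (card (R i)) \<le> real N ^ (n - 1) * (3 * t' ^ m / u)" .
    qed simp
    also have "\<dots> = (real N ^ (n - 1) * (3 * t' ^ m / u)) ^ m" by (simp add: m_def)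
    also have "real N ^ (n - 1) * (3 * t' ^ m / u) = real N ^ n * (3 * t ^ m / (T ^ n * u))"
    proof -
      have "real N ^ n = real N ^ (n - 1) * real N" using n1 by (metis power_minus_mult less_le_trans less_one)
      then show ?thesis using T q(1) by (simp add: N_def d t'_def power_add power_mult_distrib field_simps)
    qed
    also have "(\<dots>) ^ m = real (N ^ (m * n)) * (3 * t ^ m / (T ^ n * u)) ^ m"
      by (simp only: power_mult_distrib mult.commute[of m n] power_mult of_nat_power)
    finally show ?thesis .
  qed
  then show ?thesis by (simp add: Z_def N_def r_def t'_def card_grid m_def n_def)
qed

text \<open>Passing to a subcell changes A q by at most \<open>n t\<^sup>-\<^sup>d \<bar>q\<bar>\<close>. Therefore a vector that becomes short for a
subcell was already in a box of radius comparable to its own q-part, unless that is extremely small.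
This locates the vectors relevant to \<open>child_count\<close> according to the size of q.\<close>

lemma near_child_imp_near:
  fixes A :: "real ^ 'n ^ 'm" and t \<rho> :: real
  defines "d \<equiv> CARD('m + 'n)"
  assumes t: "t > 0" and T: "1 \<le> T" and L: "L \<in> grid (T ^ d)"
    and near: "infnorm (flow_vec (t * T) (corner (1 / (t * T) ^ d) A L) p q) \<le> 1"
    and q: "infnorm q \<le> \<rho> * t ^ CARD('m)" and \<rho>: "1 / T ^ CARD('n) \<le> \<rho>"
  shows "infnorm (flow_vec t A p q) \<le> (CARD('n) + 1) * \<rho>"
proof -
  define m n where "m = CARD('m)" and "n = CARD('n)"
  have d: "d = m + n" by (simp add: d_def m_def n_def card_sum_type)
  have tT: "t * T > 0" using t T by simp
  have \<rho>0: "0 < \<rho>" using \<rho> T by (smt (verit) divide_pos_pos of_nat_0_less_iff zero_less_power less_le_trans zero_less_one of_nat_1 of_nat_le_iff)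
  have qj: "\<bar>q $ j\<bar> \<le> \<rho> * t ^ m" for j using q by (simp add: infnorm_le_iff m_def)
  have "t ^ n * \<bar>(A *v q) $ i - p $ i\<bar> \<le> (real n + 1) * \<rho>" for i
  proof -
    define s where "s = (\<Sum>j\<in>UNIV. real (L $ i $ j) * q $ j)"
    have "\<bar>s\<bar> \<le> (\<Sum>j\<in>(UNIV::'n set). real (T ^ d) * (\<rho> * t ^ m))"
      unfolding s_def
    proof (rule order.trans[OF sum_abs], rule sum_mono)
      fix j
      have "real (L $ i $ j) \<le> real (T ^ d)" using L by (auto simp: grid_def less_imp_le simp del: of_nat_power)
      then show "\<bar>real (L $ i $ j) * q $ j\<bar> \<le> real (T ^ d) * (\<rho> * t ^ m)"
        unfolding abs_mult using qj[of j] by (intro mult_mono) auto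
    qed
    then have s: "\<bar>s\<bar> \<le> n * (real T ^ d * (\<rho> * t ^ m))" by (simp add: n_def)
    have "(t * T) ^ n * \<bar>((A *v q) $ i + 1 / (t * T) ^ d * s) - p $ i\<bar> \<le> 1"
      using near tT unfolding infnorm_flow_vec_le_iff[OF tT] corner_mult s_def n_def by blast
    then have "\<bar>((A *v q) $ i + 1 / (t * T) ^ d * s) - p $ i\<bar> \<le> 1 / (t * T) ^ n"
      using tT by (simp add: pos_le_divide_eq mult.commute)
    moreover have "\<bar>1 / (t * T) ^ d * s\<bar> \<le> n * \<rho> / t ^ n"
    proof -
      have "\<bar>1 / (t * T) ^ d * s\<bar> = 1 / (t * T) ^ d * \<bar>s\<bar>" using tT by (simp add: abs_mult)
      also have "\<dots> \<le> 1 / (t * T) ^ d * (n * (real T ^ d * (\<rho> * t ^ m)))"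
        using tT by (intro mult_left_mono s) auto
      also have "\<dots> = n * \<rho> / t ^ n"
        using t T by (simp add: d power_add power_mult_distrib field_simps)
      finally show ?thesis .
    qed
    ultimately have "\<bar>(A *v q) $ i - p $ i\<bar> \<le> 1 / (t * T) ^ n + n * \<rho> / t ^ n" by linarith
    also have "\<dots> = (1 / T ^ n + n * \<rho>) / t ^ n" by (simp add: power_mult_distrib add_divide_distrib mult.commute)
    also have "\<dots> \<le> (\<rho> + n * \<rho>) / t ^ n" using \<rho> t by (intro divide_right_mono) (auto simp: n_def)
    finally show ?thesis using t by (simp add: field_simps)
  qed
  moreover have "\<bar>q $ j\<bar> \<le> (real n + 1) * \<rho> * t ^ m" for j
  proof -
    have "1 * (\<rho> * t ^ m) \<le> (real n + 1) * (\<rho> * t ^ m)"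
      using \<rho>0 t by (intro mult_right_mono) auto
    then show ?thesis using qj[of j] by (simp add: mult.assoc)
  qed
  ultimately show ?thesis using t by (simp add: infnorm_flow_vec_le_iff m_def n_def add.commute)
qed

section \<open>The average height contracts under subdivision\<close>

text \<open>Large height means that the lattice has very short vectors, that is, it lies far out in the cusp of the
space of unimodular lattices.\<close>

definition height :: "real \<Rightarrow> real ^ 'n ^ 'm \<Rightarrow> real" where
  "height t A = real (card (box_points (flow_lattice t A) 1))"

lemma height_ge1: "t > 0 \<Longrightarrow> 1 \<le> height t A"
  using discrete_subgroup.one_le_card_box_points[OF discrete_subgroup_flow_lattice[of t A], of 1] by (simp add: height_def)

definition near_children :: "real \<Rightarrow> nat \<Rightarrow> real ^ 'n ^ 'm \<Rightarrow> real ^ 'm \<Rightarrow> real ^ 'n \<Rightarrow> (nat ^ 'n ^ 'm) set" where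
  "near_children t T A p q = {L \<in> grid (T ^ CARD('m + 'n)).
     infnorm (flow_vec (t * T) (corner (1 / (t * T) ^ CARD('m + 'n)) A L) p q) \<le> 1}"

lemma near_child_subset:
  fixes A :: "real ^ 'n ^ 'm" and t :: real
  assumes t: "t > 0" and T: "1 \<le> T" and L: "L \<in> grid (T ^ CARD('m + 'n))"
  shows "near_pairs (t * T) (corner (1 / (t * T) ^ CARD('m + 'n)) A L) 1
    \<subseteq> near_pairs t A ((CARD('n) + 1) * real T ^ CARD('m))"
proof clarify
  fix p q assume pq: "(p, q) \<in> near_pairs (t * T) (corner (1 / (t * T) ^ CARD('m + 'n)) A L) 1"
  have tT: "t * T > 0" using t T by simp
  have near: "infnorm (flow_vec (t * T) (corner (1 / (t * T) ^ CARD('m + 'n)) A L) p q) \<le> 1"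
    using pq by (simp add: near_pairs_def)
  then have "infnorm q \<le> real T ^ CARD('m) * t ^ CARD('m)"
    unfolding infnorm_flow_vec_le_iff[OF tT] infnorm_le_iff[of q] by (simp add: power_mult_distrib mult.commute)
  moreover have "1 / real T ^ CARD('n) \<le> 1" "1 \<le> real T ^ CARD('m)" using T by simp_all
  then have "1 / real T ^ CARD('n) \<le> real T ^ CARD('m)" by linarith
  ultimately have "infnorm (flow_vec t A p q) \<le> (CARD('n) + 1) * real T ^ CARD('m)"
    by (rule near_child_imp_near[OF t T L near])
  then show "(p, q) \<in> near_pairs t A ((CARD('n) + 1) * real T ^ CARD('m))"
    using pq by (simp add: near_pairs_def)
qed

text \<open>Double counting: the sum of the heights of all subcells counts pairs of a subcell and a label (p, q).\<close>

lemma sum_height_cells: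
  fixes A :: "real ^ 'n ^ 'm" and t :: real
  assumes t: "t > 0" and T: "1 \<le> T"
  shows "(\<Sum>L\<in>grid (T ^ CARD('m + 'n)). height (t * T) (corner (1 / (t * T) ^ CARD('m + 'n)) A L))
    = (\<Sum>(p, q)\<in>near_pairs t A ((CARD('n) + 1) * real T ^ CARD('m)). real (card (near_children t T A p q)))"
    (is "sum ?h ?G = ?R")
proof -
  define W where "W = near_pairs t A ((CARD('n) + 1) * real T ^ CARD('m))"
  have finW: "finite W" unfolding W_def by (rule finite_near_pairs[OF t])
  have tT: "t * T > 0" using t T by simp
  define P where "P L = near_pairs (t * T) (corner (1 / (t * T) ^ CARD('m + 'n)) A L) 1" for L
  have "?h L = (\<Sum>w\<in>W. of_bool (w \<in> P L))" if "L \<in> ?G" for L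
  proof -
    have "P L \<subseteq> W" unfolding P_def W_def by (rule near_child_subset[OF t T that])
    then have "(\<Sum>w\<in>W. of_bool (w \<in> P L)) = real (card (P L))"
      using finW by (simp add: Int_absorb1 flip: Int_def)
    then show ?thesis by (simp add: height_def card_box_points_flow_lattice[OF tT] P_def)
  qed
  then have "sum ?h ?G = (\<Sum>L\<in>?G. \<Sum>w\<in>W. of_bool (w \<in> P L))" by simp
  also have "\<dots> = (\<Sum>w\<in>W. \<Sum>L\<in>?G. of_bool (w \<in> P L))" by (rule sum.swap)
  also have "\<dots> = (\<Sum>(p, q)\<in>W. real (card (near_children t T A p q)))"
  proof (rule sum.cong[OF refl], clarify)
    fix p q assume "(p, q) \<in> W"
    then have "near_children t T A p q = ?G \<inter> {L. (p, q) \<in> P L}"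
      by (auto simp: W_def P_def near_pairs_def near_children_def)
    then show "(\<Sum>L\<in>?G. of_bool ((p, q) \<in> P L)) = real (card (near_children t T A p q))"
      by (simp add: finite_grid)
  qed
  finally show ?thesis by (simp add: W_def)
qed

text \<open>By \<open>child_count\<close> a vector whose q-part has size \<open>u t\<^sup>m\<close> contributes to at most a proportion \<open>(3 / (T\<^sup>n u))\<^sup>m\<close> of the
subcells. The labels are sorted by u into one bottom layer, which is controlled by the eightfold gain of
\<open>card_small_box_le\<close>, and 2m + 1 geometric layers with ratio \<open>\<kappa>\<close>. In the layer \<open>u \<approx> \<kappa>\<^sup>j\<close> the hyperplane bound
allows about \<open>\<kappa>\<^sup>j\<^sup>(\<^sup>d\<^sup>-\<^sup>1\<^sup>)\<close> times the height many labels. As \<open>u \<le> T\<^sup>m\<close> with \<open>T = \<kappa>\<^sup>2\<close>, each layer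
contributes at most \<open>\<kappa>\<^sup>-\<^sup>m\<close> times the height, up to a constant: the loss \<open>\<kappa>\<^sup>m\<close> from the coarseness of the
layers is outweighed by the gain \<open>T\<^sup>-\<^sup>m\<close>. The number of layers does not depend on \<open>\<kappa>\<close>, so that \<open>\<kappa>\<close> can be
chosen large.\<close>

lemma height_drift_nonspanning:
  fixes A :: "real ^ 'n ^ 'm" and t :: real and \<kappa> :: nat
  defines "m \<equiv> CARD('m)" and "n \<equiv> CARD('n)" and "d \<equiv> CARD('m + 'n)"
  defines "C \<equiv> (4 * d * (n + 1)) ^ (d - 1) * (66 * (n + 1)) ^ m"
  assumes t: "t > 0" and \<kappa>: "3 * (2 * m + 1) * C + 22 * (n + 1) \<le> \<kappa>"
    and nspan: "span (box_points (flow_lattice t A) ((real n + 1) * real (\<kappa>\<^sup>2) ^ m)) \<noteq> UNIV"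
  shows "(\<Sum>L\<in>grid ((\<kappa>\<^sup>2) ^ d). height (t * (\<kappa>\<^sup>2)) (corner (1 / (t * (\<kappa>\<^sup>2)) ^ d) A L))
    \<le> real (card (grid ((\<kappa>\<^sup>2) ^ d) :: (nat ^ 'n ^ 'm) set)) * (height t A / 2 + 1)"
proof -
  have d: "d = m + n" by (simp add: d_def m_def n_def card_sum_type)
  have mn1: "m \<ge> 1" "n \<ge> 1" by (simp_all add: m_def n_def Suc_leI)
  have \<kappa>1: "22 * (real n + 1) \<le> \<kappa>" "3 * (2 * real m + 1) * C \<le> \<kappa>" "1 \<le> \<kappa>"
  proof -
    have "real (3 * (2 * m + 1) * C + 22 * (n + 1)) \<le> real \<kappa>" using \<kappa> by (rule of_nat_mono)
    then show "22 * (real n + 1) \<le> \<kappa>" "3 * (2 * real m + 1) * C \<le> \<kappa>"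
      by (simp_all add: algebra_simps) (smt (verit) of_nat_0_le_iff mult_nonneg_nonneg)+
    show "1 \<le> \<kappa>" using \<kappa> by simp
  qed
  define T where "T = \<kappa>\<^sup>2"
  have T: "1 \<le> T" "real T = real \<kappa> ^ 2" "\<kappa> \<le> T" using \<kappa>1(3) by (simp_all add: T_def power2_nat_le_imp_le self_le_power)
  define G where "G = real (card (grid (T ^ d) :: (nat ^ 'n ^ 'm) set))"
  have G: "G \<ge> 0" by (simp add: G_def)
  define h where "h = height t A"
  have h: "h \<ge> 0" by (simp add: h_def height_def)
  \<comment> \<open>With this threshold \<open>near_child_imp_near\<close> puts the bottom layer into the box of radius 1/22.\<close>
  define \<sigma> where "\<sigma> = 1 / (22 * (real n + 1))"
  have \<sigma>: "0 < \<sigma>" "1 / real T ^ n \<le> \<sigma>" "1 / real \<kappa> \<le> \<sigma>"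
  proof -
    show "0 < \<sigma>" by (simp add: \<sigma>_def)
    show l: "1 / real \<kappa> \<le> \<sigma>" unfolding \<sigma>_def using \<kappa>1 by (intro divide_left_mono) auto
    have "real \<kappa> \<le> real T ^ n" using T(1,3) mn1 self_le_power[of "real T" n] by simp
    then have "1 / real T ^ n \<le> 1 / real \<kappa>" using \<kappa>1(3) T(1) by (intro divide_left_mono mult_pos_pos) auto
    with l show "1 / real T ^ n \<le> \<sigma>" by simp
  qed
  define cnt where "cnt w = real (card (near_children t T A (fst w) (snd w)))" for w
  have cnt0: "0 \<le> cnt w" for w by (simp add: cnt_def)
  have cntG: "cnt w \<le> G" for w
    unfolding cnt_def G_def near_children_def d_def by (auto intro!: card_mono finite_grid)
  define R where "R = (real n + 1) * real T ^ m"
  define W where "W = near_pairs t A R"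
  have finW: "finite W" unfolding W_def by (rule finite_near_pairs[OF t])
  \<comment> \<open>For j = 0 the lower end of the layer lies below \<open>\<sigma>\<close>, which is harmless; it keeps the formula uniform in j.\<close>
  define V where "V j = {w \<in> near_pairs t A ((real n + 1) * real \<kappa> ^ j). \<sigma> * real \<kappa> ^ j / \<kappa> * t ^ m < infnorm (snd w)}" for j
  have finV: "finite (V j)" for j unfolding V_def by (simp add: finite_near_pairs[OF t])
  define V0 where "V0 = near_pairs t A (1/22)"
  have finV0: "finite V0" unfolding V0_def by (rule finite_near_pairs[OF t])

  have cover: "{w \<in> W. cnt w \<noteq> 0} \<subseteq> V0 \<union> (\<Union>j\<in>{..2*m}. V j)"
  proof clarify
    fix p q assume w: "(p, q) \<in> W" "cnt (p, q) \<noteq> 0" "(p, q) \<notin> (\<Union>j\<in>{..2*m}. V j)"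
    then obtain L where "L \<in> near_children t T A p q" unfolding cnt_def by fastforce
    then have L: "L \<in> grid (T ^ CARD('m + 'n))"
      "infnorm (flow_vec (t * T) (corner (1 / (t * T) ^ CARD('m + 'n)) A L) p q) \<le> 1"
      by (auto simp: near_children_def)
    have tT: "t * T > 0" using t T(1) by simp
    have pq: "p \<in> int_lattice" "q \<in> int_lattice" using w(1) by (auto simp: W_def near_pairs_def)
    have near: "(p, q) \<in> near_pairs t A ((real n + 1) * \<rho>)"
      if "infnorm q \<le> \<rho> * t ^ m" "1 / real T ^ n \<le> \<rho>" for \<rho> :: real
      using near_child_imp_near[OF t T(1) L, of \<rho>] that pq
      by (auto simp: near_pairs_def m_def n_def algebra_simps)
    have "infnorm q \<le> real T ^ m * t ^ m"
      using L(2) unfolding infnorm_flow_vec_le_iff[OF tT] infnorm_le_iff[of q] m_def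
      by (simp add: power_mult_distrib mult.commute)
    then have top: "infnorm q \<le> real \<kappa> ^ (2 * m) * t ^ m" by (simp add: T(2) flip: power_mult)
    show "(p, q) \<in> V0"
    proof (cases "infnorm q \<le> \<sigma> * t ^ m")
      case True
      have "(real n + 1) * \<sigma> = 1 / 22" by (simp add: \<sigma>_def divide_simps)
      then show ?thesis using near[OF True \<sigma>(2)] by (simp only: V0_def)
    next
      case False
      define P where "P i \<longleftrightarrow> infnorm q \<le> real \<kappa> ^ i * t ^ m" for i
      define j where "j = (LEAST i. P i)"
      have top: "P (2 * m)" using top by (simp only: P_def)
      have "P j" unfolding j_def by (rule LeastI[of P, OF top])
      then have j: "infnorm q \<le> real \<kappa> ^ j * t ^ m" by (simp only: P_def)
      have j2: "j \<le> 2 * m" unfolding j_def by (rule Least_le[of P, OF top])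
      have lower: "\<sigma> * real \<kappa> ^ j / \<kappa> * t ^ m < infnorm q"
      proof (cases j)
        case 0
        have "\<sigma> / \<kappa> * t ^ m \<le> \<sigma> * t ^ m"
          using \<sigma>(1) \<kappa>1(3) t by (intro mult_right_mono) (auto simp: divide_le_eq)
        then show ?thesis using False 0 by simp
      next
        case (Suc i)
        then have "\<not> P i" unfolding j_def by (intro not_less_Least) simp
        then have "\<not> infnorm q \<le> real \<kappa> ^ i * t ^ m" unfolding P_def .
        moreover have "\<sigma> * real \<kappa> ^ j / \<kappa> * t ^ m = \<sigma> * (real \<kappa> ^ i * t ^ m)"
          using Suc \<kappa>1(3) by simp
        moreover have "\<sigma> * (real \<kappa> ^ i * t ^ m) \<le> 1 * (real \<kappa> ^ i * t ^ m)"
          using t by (intro mult_right_mono) (auto simp: \<sigma>_def)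
        ultimately show ?thesis by simp
      qed
      have "1 / real T ^ n \<le> 1" "1 \<le> real \<kappa> ^ j" using T \<kappa>1 by simp_all
      then have "1 / real T ^ n \<le> real \<kappa> ^ j" by linarith
      from near[OF j this] lower have "(p, q) \<in> V j" by (simp add: V_def)
      then show ?thesis using w(3) j2 by blast
    qed
  qed

  have sumV0: "sum cnt V0 \<le> G * (1 + h / 8)"
  proof -
    have "sum cnt V0 \<le> real (card V0) * G" using sum_mono[of V0 cnt "\<lambda>_. G"] cntG by simp
    also have "real (card V0) \<le> 1 + h / 8"
      using discrete_subgroup.card_small_box_le[OF discrete_subgroup_flow_lattice[OF t], of A]
      by (simp add: V0_def h_def height_def card_box_points_flow_lattice[OF t])
    finally show ?thesis using G by (simp add: mult.commute mult_right_mono)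
  qed

  have sumV: "sum cnt (V j) \<le> G * h * (C / \<kappa>)" if j: "j \<le> 2 * m" for j
  proof -
    define u where "u = \<sigma> * real \<kappa> ^ j / \<kappa> * t ^ m"
    have u: "u > 0" using \<sigma> \<kappa>1 t by (simp add: u_def)
    define f where "f = (3 * t ^ m / (real T ^ n * u)) ^ m"
    have f0: "f \<ge> 0" using t u by (simp add: f_def)
    have f: "f = real (66 * (n + 1)) ^ m * (real \<kappa> ^ m / (real \<kappa> ^ (2 * n * m) * real \<kappa> ^ (j * m)))"
    proof -
      have "3 * t ^ m / (real T ^ n * u) = real (66 * (n + 1)) * (\<kappa> / (real \<kappa> ^ (2 * n) * real \<kappa> ^ j))"
        using t \<kappa>1(3) by (simp add: u_def \<sigma>_def T(2) field_simps flip: power_mult)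
      then show ?thesis by (simp add: f_def power_mult_distrib power_divide power_mult)
    qed
    have "cnt w \<le> G * f" if "w \<in> V j" for w
      unfolding cnt_def G_def f_def near_children_def d_def m_def n_def
      using that u by (intro child_count[OF t T(1) u[unfolded m_def]]) (simp add: V_def u_def m_def)
    then have "sum cnt (V j) \<le> real (card (V j)) * (G * f)"
      using sum_mono[of "V j" cnt "\<lambda>_. G * f"] by simp
    also have "\<dots> \<le> ((real (4 * d * (n + 1)) * real \<kappa> ^ j) ^ (d - 1) * h) * (G * f)"
    proof (rule mult_right_mono)
      define r where "r = (real n + 1) * real \<kappa> ^ j"
      have "1 \<le> real \<kappa> ^ j" using \<kappa>1 by simp
      then have r1: "1 \<le> r" unfolding r_def by (smt (verit) mult_le_cancel_left1 of_nat_1 of_nat_add of_nat_0_le_iff)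
      have "real \<kappa> ^ j \<le> real \<kappa> ^ (2 * m)" using j \<kappa>1 by (intro power_increasing) auto
      then have "r \<le> (real n + 1) * real T ^ m" unfolding r_def
        by (intro mult_left_mono) (auto simp: T(2) simp flip: power_mult)
      then have "box_points (flow_lattice t A) r \<subseteq> box_points (flow_lattice t A) ((real n + 1) * real (\<kappa>\<^sup>2) ^ m)"
        by (auto simp: box_points_def T_def)
      from span_mono[OF this] have "span (box_points (flow_lattice t A) r) \<noteq> UNIV"
        using nspan by (metis top.extremum_uniqueI)
      from discrete_subgroup.card_box_le_in_hyperplane[OF discrete_subgroup_flow_lattice[OF t] r1 this]
      have "real (card (near_pairs t A r)) \<le> (real (4 * d) * r) ^ (d - 1) * h"
        by (simp add: card_box_points_flow_lattice[OF t] d_def h_def height_def)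
      moreover have "card (V j) \<le> card (near_pairs t A r)"
        by (intro card_mono finite_near_pairs[OF t]) (auto simp: V_def r_def)
      ultimately have "real (card (V j)) \<le> (real (4 * d) * r) ^ (d - 1) * h"
        by linarith
      also have "real (4 * d) * r = real (4 * d * (n + 1)) * real \<kappa> ^ j"
        by (simp add: r_def algebra_simps)
      finally show "real (card (V j)) \<le> (real (4 * d * (n + 1)) * real \<kappa> ^ j) ^ (d - 1) * h" .
    qed (use G f0 in simp)
    also have "\<dots> = G * h * (C * ((real \<kappa> ^ (j * (d - 1)) * real \<kappa> ^ m) / (real \<kappa> ^ (2 * n * m) * real \<kappa> ^ (j * m))))"
      unfolding f C_def by (simp add: power_mult_distrib power_mult)
    also have "\<dots> \<le> G * h * (C * (1 / \<kappa>))"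
    proof (intro mult_left_mono)
      have "d - 1 = m + (n - 1)" using d mn1 by simp
      then have e: "j * (d - 1) = j * m + j * (n - 1)" by (simp add: add_mult_distrib2)
      \<comment> \<open>Comparison of exponents of \<open>\<kappa>\<close>: with \<open>j \<le> 2m\<close> the total exponent is at most -m, hence at most -1.\<close>
      have "j * (n - 1) + m + 1 \<le> 2 * m * (n - 1) + m + m" using j mn1 by (intro add_mono mult_le_mono1) auto
      also have "\<dots> = 2 * n * m" using mn1 by (cases n) (auto simp: algebra_simps)
      finally have "real \<kappa> ^ (j * (n - 1) + m + 1) \<le> real \<kappa> ^ (2 * n * m)"
        using \<kappa>1 by (intro power_increasing) auto
      then show "(real \<kappa> ^ (j * (d - 1)) * real \<kappa> ^ m) / (real \<kappa> ^ (2 * n * m) * real \<kappa> ^ (j * m)) \<le> 1 / \<kappa>"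
        using \<kappa>1(3) unfolding e by (simp add: power_add field_simps)
    qed (use G h in auto)
    finally show ?thesis by simp
  qed

  have "sum cnt W = sum cnt {w \<in> W. cnt w \<noteq> 0}"
    using finW by (intro sum.mono_neutral_right) auto
  also have "\<dots> \<le> sum cnt (V0 \<union> (\<Union>j\<in>{..2*m}. V j))"
    using cover finV finV0 cnt0 by (intro sum_mono2) auto
  also have "\<dots> \<le> sum cnt V0 + sum cnt (\<Union>j\<in>{..2*m}. V j)"
    using sum.union_inter[of V0 "\<Union>j\<in>{..2*m}. V j" cnt] finV finV0
      sum_nonneg[of "V0 \<inter> (\<Union>j\<in>{..2*m}. V j)" cnt] cnt0 by (simp add: algebra_simps)
  also have "sum cnt (\<Union>j\<in>{..2*m}. V j) \<le> (\<Sum>j\<in>{..2*m}. sum cnt (V j))"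
    by (intro sum_UN_le_nonneg finV cnt0) auto
  also have "\<dots> \<le> (\<Sum>j\<in>{..2*m}. G * h * (C / \<kappa>))" by (intro sum_mono sumV) simp
  also have "\<dots> = G * h * (((2 * real m + 1) * C) / \<kappa>)" by (simp add: algebra_simps add_divide_distrib)
  also have "\<dots> \<le> G * h * (3 / 8)"
  proof -
    define x where "x = (2 * real m + 1) * C"
    have "3 * x \<le> \<kappa>" "0 \<le> x" using \<kappa>1(2) by (simp_all only: x_def mult.assoc) simp
    then have "x / \<kappa> \<le> 3 / 8" using \<kappa>1(3) by (simp add: divide_le_eq)
    then show ?thesis using G h unfolding x_def by (intro mult_left_mono) auto
  qed
  also note sumV0
  finally have "sum cnt W \<le> G * (h / 2 + 1)" by (simp add: algebra_simps)
  then show ?thesis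
    using sum_height_cells[OF t T(1), of A]
    by (simp add: W_def R_def cnt_def case_prod_beta m_def n_def d_def G_def h_def T_def add.commute)
qed

text \<open>In the spanning case the subcells have bounded height, because their unit boxes correspond to subsets of
a fixed box of the original lattice.\<close>

lemma height_drift:
  obtains T :: nat and b :: real where "2 \<le> T" "1 \<le> b"
    "\<And>(t :: real) (A :: real ^ 'n ^ 'm). t > 0 \<Longrightarrow>
      (\<Sum>L\<in>grid (T ^ CARD('m + 'n)). height (t * T) (corner (1 / (t * T) ^ CARD('m + 'n)) A L))
      \<le> real (card (grid (T ^ CARD('m + 'n)) :: (nat ^ 'n ^ 'm) set)) * (height t A / 2 + b)"
proof -
  define m n d where "m = CARD('m)" and "n = CARD('n)" and "d = CARD('m + 'n)"
  define \<kappa> where "\<kappa> = 3 * (2 * m + 1) * ((4 * d * (n + 1)) ^ (d - 1) * (66 * (n + 1)) ^ m) + 22 * (n + 1)"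
  define T where "T = \<kappa>\<^sup>2"
  have \<kappa>: "22 \<le> \<kappa>" by (simp add: \<kappa>_def)
  have T: "22 \<le> T" unfolding T_def using self_le_power[of \<kappa> 2] \<kappa> by linarith
  define R where "R = (real n + 1) * real T ^ m"
  have R: "R \<ge> 1"
  proof -
    have "1 * 1 \<le> (real n + 1) * real T ^ m" using T by (intro mult_mono) auto
    then show ?thesis by (simp add: R_def add.commute)
  qed
  \<comment> \<open>The count in the box of radius R in the spanning case.\<close>
  define b where "b = (12 * d * R) ^ d"
  have b: "b \<ge> 1" unfolding b_def
  proof (rule one_le_power)
    have "d \<ge> 1" by (simp add: d_def Suc_leI)
    then have "1 * 1 \<le> real (12 * d) * R" using R by (intro mult_mono) auto
    then show "1 \<le> real (12 * d) * R" by simp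
  qed
  have main: "(\<Sum>L\<in>grid (T ^ CARD('m + 'n)). height (t * T) (corner (1 / (t * T) ^ CARD('m + 'n)) A L))
      \<le> real (card (grid (T ^ CARD('m + 'n)) :: (nat ^ 'n ^ 'm) set)) * (height t A / 2 + b)"
    if t: "t > 0" for t :: real and A :: "real ^ 'n ^ 'm"
  proof -
    define G where "G = real (card (grid (T ^ d) :: (nat ^ 'n ^ 'm) set))"
    have "(\<Sum>L\<in>grid (T ^ d). height (t * T) (corner (1 / (t * T) ^ d) A L)) \<le> G * (height t A / 2 + b)"
    proof (cases "span (box_points (flow_lattice t A) R) = UNIV")
      case True
      have "height (t * T) (corner (1 / (t * T) ^ d) A L) \<le> b" if L: "L \<in> grid (T ^ d)" for L
      proof -
        have tT: "t * T > 0" using t T by simp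
        have "height (t * T) (corner (1 / (t * T) ^ d) A L) = card (near_pairs (t * T) (corner (1 / (t * T) ^ d) A L) 1)"
          by (simp add: height_def card_box_points_flow_lattice[OF tT])
        also have "\<dots> \<le> card (near_pairs t A R)"
        proof -
          have "1 \<le> T" using T by simp
          from near_child_subset[OF t this L[unfolded d_def], of A]
          have "near_pairs (t * T) (corner (1 / (t * T) ^ d) A L) 1 \<subseteq> near_pairs t A R"
            by (simp add: R_def d_def n_def m_def add.commute)
          from card_mono[OF finite_near_pairs[OF t] this] show ?thesis by simp
        qed
        also have "\<dots> \<le> b"
          using card_flow_box_le_if_spanning[OF t _ True] R unfolding b_def d_def by (simp add: card_box_points_flow_lattice[OF t])
        finally show ?thesis .
      qed
      then have "(\<Sum>L\<in>grid (T ^ d). height (t * T) (corner (1 / (t * T) ^ d) A L)) \<le> (\<Sum>L\<in>(grid (T ^ d) :: (nat ^ 'n ^ 'm) set). b)"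
        by (intro sum_mono)
      also have "\<dots> = G * b" by (simp add: G_def)
      also have "\<dots> \<le> G * (height t A / 2 + b)" by (intro mult_left_mono) (auto simp: G_def height_def)
      finally show ?thesis .
    next
      case False
      have "(\<Sum>L\<in>grid (T ^ d). height (t * T) (corner (1 / (t * T) ^ d) A L)) \<le> G * (height t A / 2 + 1)"
      proof -
        note * = height_drift_nonspanning[OF t, of \<kappa> A, folded m_def n_def d_def]
        have "3 * (2 * m + 1) * ((4 * d * (n + 1)) ^ (d - 1) * (66 * (n + 1)) ^ m) + 22 * (n + 1) \<le> \<kappa>"
          by (simp only: \<kappa>_def)
        moreover have "span (box_points (flow_lattice t A) ((real n + 1) * real (\<kappa>\<^sup>2) ^ m)) \<noteq> UNIV"
          using False by (simp only: R_def T_def simp_thms)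
        ultimately show ?thesis using * by (simp only: T_def G_def of_nat_add of_nat_1 simp_thms True_implies_equals not_False_eq_True)
      qed
      also have "\<dots> \<le> G * (height t A / 2 + b)" using b by (intro mult_left_mono) (auto simp: G_def)
      finally show ?thesis .
    qed
    then show ?thesis by (simp only: G_def d_def)
  qed
  show ?thesis by (rule that[OF _ b main]) (use T in auto)
qed

lemma sum_grid_split:
  fixes f :: "nat ^ 'n ^ 'm \<Rightarrow> real"
  assumes "0 < N'"
  shows "sum f (grid (N * N')) = (\<Sum>K\<in>grid N. \<Sum>L\<in>grid N'. f (\<chi> i j. N' * K $ i $ j + L $ i $ j))"
proof -
  have lt: "N' * a + b < N * N'" if "a < N" "b < N'" for a b :: nat
  proof -
    have "N' * a + b < N' * (a + 1)" using that by simp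
    also have "\<dots> \<le> N' * N" using that by (intro mult_le_mono2) simp
    finally show ?thesis by (simp add: mult.commute)
  qed
  have "(\<Sum>K\<in>grid N. \<Sum>L\<in>grid N'. f (\<chi> i j. N' * K $ i $ j + L $ i $ j)) =
    (\<Sum>(K, L)\<in>grid N \<times> grid N'. f (\<chi> i j. N' * K $ i $ j + L $ i $ j))"
    by (rule sum.cartesian_product)
  also have "\<dots> = sum f (grid (N * N'))"
    by (rule sum.reindex_bij_witness[where
          i = "\<lambda>M. ((\<chi> i j. M $ i $ j div N') :: nat ^ 'n ^ 'm, (\<chi> i j. M $ i $ j mod N') :: nat ^ 'n ^ 'm)"
          and j = "\<lambda>(K, L). (\<chi> i j. N' * K $ i $ j + L $ i $ j)"])
      (use assms lt in \<open>auto simp: grid_def vec_eq_iff less_mult_imp_div_less\<close>)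
  finally show ?thesis by simp
qed

lemma card_grid_mult:
  "card (grid (N * N') :: (nat ^ 'n ^ 'm) set) = card (grid N :: (nat ^ 'n ^ 'm) set) * card (grid N' :: (nat ^ 'n ^ 'm) set)"
  by (simp add: card_grid power_mult_distrib)

lemma corner_corner:
  assumes "r = real N * r'"
  shows "corner r' A (\<chi> i j. N * K $ i $ j + L $ i $ j) = corner r' (corner r A K) L"
  by (simp add: corner_def vec_eq_iff assms algebra_simps)

text \<open>Iterating keeps the additive constant below 2b for every s. This allows the number s of steps to be
chosen afterwards, depending on the height threshold that the constant dictates.\<close>

lemma height_drift_iterate:
  fixes T :: nat and b :: real
  assumes T: "2 \<le> T"
    and drift: "\<And>(t :: real) (A :: real ^ 'n ^ 'm). t > 0 \<Longrightarrow>
      (\<Sum>L\<in>grid (T ^ CARD('m + 'n)). height (t * real T) (corner (1 / (t * real T) ^ CARD('m + 'n)) A L))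
      \<le> real (card (grid (T ^ CARD('m + 'n)) :: (nat ^ 'n ^ 'm) set)) * (height t A / 2 + b)"
    and t: "t > 0"
  shows "(\<Sum>L\<in>grid ((T ^ s) ^ CARD('m + 'n)).
      height (t * real (T ^ s)) (corner (1 / (t * real (T ^ s)) ^ CARD('m + 'n)) (A :: real ^ 'n ^ 'm) L))
    \<le> real (card (grid ((T ^ s) ^ CARD('m + 'n)) :: (nat ^ 'n ^ 'm) set)) * (height t A / 2 ^ s + 2 * b * (1 - 1 / 2 ^ s))"
proof (induction s)
  case 0
  have "(grid (Suc 0) :: (nat ^ 'n ^ 'm) set) = {0}" by (auto simp: grid_def vec_eq_iff)
  moreover have "corner r A 0 = A" for r by (simp add: corner_def vec_eq_iff)
  ultimately show ?case by simp
next
  case (Suc s)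
  define d where "d = CARD('m + 'n)"
  define N N' where "N = (T ^ s) ^ d" and "N' = T ^ d"
  define g g' where "g = real (card (grid N :: (nat ^ 'n ^ 'm) set))" and "g' = real (card (grid N' :: (nat ^ 'n ^ 'm) set))"
  define u where "u = t * real (T ^ s)"
  have u: "u > 0" using t T by (simp add: u_def)
  have N': "N' > 0" using T by (simp add: N'_def)
  have NN: "(T ^ Suc s) ^ d = N * N'" by (simp add: N_def N'_def power_mult_distrib mult.commute)
  have uT: "t * real (T ^ Suc s) = u * real T" by (simp add: u_def mult_ac)
  have r: "1 / u ^ d = real N' * (1 / (u * real T) ^ d)"
    using u T by (simp add: N'_def power_mult_distrib)
  have "(\<Sum>L\<in>grid (N * N'). height (u * real T) (corner (1 / (u * real T) ^ d) A L))
    = (\<Sum>K\<in>grid N. \<Sum>L\<in>grid N'. height (u * real T) (corner (1 / (u * real T) ^ d) (corner (1 / u ^ d) A K) L))"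
    unfolding sum_grid_split[OF N'] corner_corner[OF r] ..
  also have "\<dots> \<le> (\<Sum>K\<in>grid N. g' * (height u (corner (1 / u ^ d) A K) / 2 + b))"
    unfolding g'_def N'_def d_def by (intro sum_mono drift u)
  also have "\<dots> = g' * ((\<Sum>K\<in>grid N. height u (corner (1 / u ^ d) A K)) / 2 + g * b)"
    by (simp add: g_def sum.distrib sum_divide_distrib flip: sum_distrib_left)
  also have "\<dots> \<le> g' * (g * (height t A / 2 ^ s + 2 * b * (1 - 1 / 2 ^ s)) / 2 + g * b)"
  proof (intro mult_left_mono add_right_mono divide_right_mono)
    show "(\<Sum>K\<in>grid N. height u (corner (1 / u ^ d) A K)) \<le> g * (height t A / 2 ^ s + 2 * b * (1 - 1 / 2 ^ s))"
      using Suc.IH unfolding g_def N_def u_def d_def .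
  qed (simp_all add: g'_def)
  also have "\<dots> = (g * g') * (height t A / 2 ^ Suc s + 2 * b * (1 - 1 / 2 ^ Suc s))"
    by (simp add: field_simps)
  also have "g * g' = real (card (grid (N * N') :: (nat ^ 'n ^ 'm) set))"
    by (simp add: g_def g'_def card_grid_mult)
  finally show ?case by (simp only: NN uT flip: d_def)
qed

section \<open>Low cells contain subcells without bad matrices\<close>

text \<open>The \<open>\<epsilon>\<close>-bad matrices are covered by countably many sets of this form with \<open>\<epsilon>/2\<close> in place of \<open>\<epsilon>\<close>; within one of them the approximation
inequality fails for all q beyond an explicit bound, so that a single q shows that a cell is free of it.\<close>

definition bad_from :: "real \<Rightarrow> real ^ 'm \<Rightarrow> real \<Rightarrow> (real ^ 'n ^ 'm) set" where
  "bad_from Q b \<epsilon> = {A. \<forall>q\<in>int_lattice. Q \<le> norm q \<longrightarrow>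
     \<epsilon> < norm q powr (real CARD('n) / real CARD('m)) * lattice_dist (A *v q - b)}"

definition cell :: "real \<Rightarrow> real ^ 'n ^ 'm \<Rightarrow> (real ^ 'n ^ 'm) set" where
  "cell r A = {X. \<forall>i j. A $ i $ j \<le> X $ i $ j \<and> X $ i $ j < A $ i $ j + r}"

lemma lattice_dist_le:
  assumes "p \<in> int_lattice"
  shows "lattice_dist v \<le> norm (v - p)"
  unfolding lattice_dist_def by (rule cINF_lower[OF _ assms]) (auto intro!: bdd_belowI[of _ 0])

text \<open>If the vectors in the box of radius \<open>\<rho>\<close> lay in a hyperplane, their number would be at most of order
\<open>\<rho>\<^sup>d\<^sup>-\<^sup>1 M\<close>, whereas by pigeonhole it is at least of order \<open>\<rho>\<^sup>d\<close>. The value of \<open>\<rho>\<close> makes these incompatible.\<close>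

lemma spanning_if_height_le:
  fixes A :: "real ^ 'n ^ 'm" and t M \<rho> :: real
  assumes h: "height t A \<le> M" and M: "1 \<le> M"
    and \<rho>: "\<rho> = 2 ^ CARD('m) * (4 * real CARD('m + 'n)) ^ (CARD('m + 'n) - 1) * M + 1" and t: "\<rho> \<le> t"
  shows "span (box_points (flow_lattice t A) \<rho>) = UNIV"
proof (rule ccontr)
  define d where "d = CARD('m + 'n)"
  have d1: "d \<ge> 1" by (simp add: d_def Suc_leI)
  assume nspan: "span (box_points (flow_lattice t A) \<rho>) \<noteq> UNIV"
  have \<rho>1: "1 \<le> \<rho>" using M by (simp add: \<rho>)
  have t0: "t > 0" "1 \<le> t" using t \<rho>1 by auto
  have "\<rho> \<le> t ^ CARD('n)" using t self_le_power[OF t0(2), of "CARD('n)"] by simp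
  then have "\<rho> ^ d / 2 ^ CARD('m) \<le> real (card (box_points (flow_lattice t A) \<rho>))"
    unfolding d_def using \<rho>1 t0 by (intro card_box_ge) auto
  also have "\<dots> \<le> (real (4 * d) * \<rho>) ^ (d - 1) * real (card (box_points (flow_lattice t A) 1))"
    using discrete_subgroup.card_box_le_in_hyperplane[OF discrete_subgroup_flow_lattice[OF t0(1)] \<rho>1 nspan] unfolding d_def .
  also have "\<dots> \<le> (real (4 * d) * \<rho>) ^ (d - 1) * M"
    using h \<rho>1 by (intro mult_left_mono) (auto simp: height_def)
  finally have "\<rho> ^ d \<le> 2 ^ CARD('m) * ((4 * real d) ^ (d - 1) * M) * \<rho> ^ (d - 1)"
    by (simp add: divide_le_eq power_mult_distrib mult_ac)
  moreover have "\<rho> ^ d = \<rho> * \<rho> ^ (d - 1)" using d1 by (metis power_eq_if not_one_le_zero)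
  moreover have "\<rho> ^ (d - 1) > 0" using \<rho>1 by simp
  ultimately have "\<rho> \<le> 2 ^ CARD('m) * ((4 * real d) ^ (d - 1) * M)"
    by (metis mult_le_cancel_right_pos)
  then show False by (simp add: \<rho> d_def)
qed

text \<open>A lattice point near the target \<open>(t\<^sup>n b - 2D, 5D)\<close> has all coordinates of q positive and of size between
\<open>4D t\<^sup>m\<close> and \<open>6D t\<^sup>m\<close>, and A q - p slightly below b. Raising all entries of row i by the same small
amount \<open>\<tau> i\<close> removes the deficit. The shift by -2D in the target makes \<open>\<tau> i\<close> nonnegative and the
5D makes it small, so that the corrected matrix stays in the cell with corner A.\<close>

lemma hit_near:
  fixes A :: "real ^ 'n ^ 'm" and t \<rho> D :: real and b :: "real ^ 'm"
  assumes t: "t > 0" and \<rho>: "\<rho> \<ge> 1" and span: "span (box_points (flow_lattice t A) \<rho>) = UNIV"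
    and D: "D = real CARD('m + 'n) * \<rho>"
  obtains p q \<tau> where "p \<in> int_lattice" "q \<in> int_lattice"
    "\<And>j. 4 * D * t ^ CARD('m) \<le> q $ j" "\<And>j. q $ j \<le> 6 * D * t ^ CARD('m)"
    "\<And>i. 0 \<le> \<tau> i" "\<And>i. \<tau> i < 1 / t ^ CARD('m + 'n)"
    "\<And>i. (A *v q) $ i + \<tau> i * (\<Sum>j\<in>UNIV. q $ j) = p $ i + b $ i"
proof -
  define m n where "m = CARD('m)" and "n = CARD('n)"
  have D1: "D \<ge> 1"
  proof -
    have "1 \<le> real CARD('m + 'n)" using two_le_card_sum_type[where ?'m='m and ?'n='n] by linarith
    then have "1 * 1 \<le> real CARD('m + 'n) * \<rho>" using \<rho> by (intro mult_mono) auto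
    then show ?thesis by (simp add: D)
  qed
  define z :: "real ^ ('m + 'n)" where "z = (\<chi> i. case i of Inl i \<Rightarrow> t ^ n * b $ i - 2 * D | Inr j \<Rightarrow> 5 * D)"
  obtain x where x: "x \<in> flow_lattice t A" "infnorm (z - x) \<le> D"
    using discrete_subgroup.covering_if_spanning[OF discrete_subgroup_flow_lattice[OF t] span] unfolding D by blast
  then obtain p q where pq: "p \<in> int_lattice" "q \<in> int_lattice" "x = flow_vec t A p q"
    unfolding flow_lattice_def by blast
  have c: "\<bar>t ^ n * b $ i - 2 * D - t ^ n * ((A *v q) $ i - p $ i)\<bar> \<le> D" "\<bar>5 * D - q $ j / t ^ m\<bar> \<le> D" for i j
    using x(2) unfolding infnorm_le_iff all_sum_type pq(3) by (simp_all add: z_def n_def m_def)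
  have q: "4 * D * t ^ m \<le> q $ j" "q $ j \<le> 6 * D * t ^ m" for j
  proof -
    have "4 * D \<le> q $ j / t ^ m" "q $ j / t ^ m \<le> 6 * D" using c(2)[of j] by linarith+
    then show "4 * D * t ^ m \<le> q $ j" "q $ j \<le> 6 * D * t ^ m" using t by (simp_all add: field_simps)
  qed
  define S where "S = (\<Sum>j\<in>UNIV. q $ j)"
  have S: "4 * D * t ^ m \<le> S"
  proof -
    obtain j0 :: 'n where True by blast
    have "q $ j0 \<le> S" unfolding S_def using q(1) D1 t
      by (intro member_le_sum) (auto intro: order.trans[OF _ q(1)])
    then show ?thesis using q(1)[of j0] by linarith
  qed
  have S0: "S > 0" using S D1 t by (smt (verit) mult_pos_pos zero_less_power)
  define y where "y i = (A *v q) $ i - p $ i - b $ i" for i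
  have y: "t ^ n * y i \<le> - D" "- 3 * D \<le> t ^ n * y i" for i
    using c(1)[of i] by (simp_all add: y_def algebra_simps abs_le_iff)
  define \<tau> where "\<tau> i = - y i / S" for i
  show ?thesis
  proof (rule that[OF pq(1,2)])
    show "4 * D * t ^ CARD('m) \<le> q $ j" "q $ j \<le> 6 * D * t ^ CARD('m)" for j using q by (simp_all add: m_def)
    have y0: "y i \<le> 0" for i
    proof (rule ccontr)
      assume "\<not> y i \<le> 0"
      then have "0 < t ^ n * y i" using t by simp
      then show False using y(1)[of i] D1 by linarith
    qed
    then show "0 \<le> \<tau> i" for i using S0 by (simp add: \<tau>_def divide_nonpos_pos)
    show "\<tau> i < 1 / t ^ CARD('m + 'n)" for i
    proof -
      have "t ^ n * (- y i) \<le> 3 * D" using y(2)[of i] by simp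
      then have "t ^ m * (t ^ n * (- y i)) \<le> t ^ m * (3 * D)" using t by (intro mult_left_mono) auto
      also have "\<dots> < 4 * D * t ^ m" using D1 t by simp
      also note S
      finally have "t ^ CARD('m + 'n) * (- y i) < S"
        by (simp add: card_sum_type power_add m_def n_def mult.assoc)
      then show ?thesis using S0 t by (simp add: \<tau>_def field_simps)
    qed
    show "(A *v q) $ i + \<tau> i * (\<Sum>j\<in>UNIV. q $ j) = p $ i + b $ i" for i
      using S0 by (simp add: \<tau>_def y_def flip: S_def)
  qed
qed

text \<open>The number s of further scales depends only on \<open>\<epsilon>\<close> and M: on a cell of side \<open>(t T\<^sup>s)\<^sup>-\<^sup>d\<close> around a matrix
that solves the congruence exactly, the error of approximation times \<open>\<bar>q\<bar>\<^sup>n\<^sup>/\<^sup>m\<close> is at most a constant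
times \<open>T\<^sup>-\<^sup>s\<^sup>d\<close>, uniformly in b, t and Q.\<close>

lemma hit_cell:
  fixes M \<epsilon> :: real and T :: nat
  assumes \<epsilon>: "\<epsilon> > 0" and M: "1 \<le> M" and T: "2 \<le> T"
  obtains s where "1 \<le> s"
    "\<And>Q t (A :: real ^ 'n ^ 'm) b. \<lbrakk>2 ^ CARD('m) * (4 * real CARD('m + 'n)) ^ (CARD('m + 'n) - 1) * M + 1 \<le> t;
        Q \<le> t; height t A \<le> M\<rbrakk> \<Longrightarrow>
      \<exists>L\<in>grid ((T ^ s) ^ CARD('m + 'n)).
        cell (1 / (t * real (T ^ s)) ^ CARD('m + 'n)) (corner (1 / (t * real (T ^ s)) ^ CARD('m + 'n)) A L)
          \<inter> bad_from Q b \<epsilon> = {}"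
proof -
  define m n d where "m = CARD('m)" and "n = CARD('n)" and "d = CARD('m + 'n)"
  have d: "d = m + n" by (simp add: d_def m_def n_def card_sum_type)
  have mn1: "m \<ge> 1" "n \<ge> 1" by (simp_all add: m_def n_def Suc_leI)
  define \<rho> where "\<rho> = 2 ^ CARD('m) * (4 * real CARD('m + 'n)) ^ (CARD('m + 'n) - 1) * M + 1"
  have \<rho>: "\<rho> \<ge> 1" using M by (simp add: \<rho>_def)
  define D where "D = real CARD('m + 'n) * \<rho>"
  have D1: "D \<ge> 1"
  proof -
    have "1 \<le> real CARD('m + 'n)" using two_le_card_sum_type[where ?'m='m and ?'n='n] by linarith
    then have "1 * 1 \<le> real CARD('m + 'n) * \<rho>" using \<rho> by (intro mult_mono) auto
    then show ?thesis by (simp add: D_def)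
  qed
  \<comment> \<open>K bounds \<open>\<bar>q\<bar>\<^sup>n\<^sup>/\<^sup>m\<close> times the error, before the gain from the s additional scales.\<close>
  define K where "K = (6 * n * D) powr (real n / real m) * (6 * m * n * D)"
  have K: "K \<ge> 0" using D1 by (simp add: K_def)
  obtain s0 :: nat where s0: "K / \<epsilon> < real s0" using reals_Archimedean2 by blast
  define s where "s = max 1 s0"
  have s: "K / \<epsilon> \<le> real (T ^ s) ^ d"
  proof -
    have "s < T ^ s" using T by (simp add: less_exp power_gt_expt)
    then have "real s \<le> real (T ^ s)" by linarith
    also have "\<dots> \<le> real (T ^ s) ^ d" using T mn1 by (intro self_le_power) (auto simp: d)
    finally show ?thesis using s0 by (simp add: s_def)
  qed
  show ?thesis
  proof (rule that[of s])
    fix Q t :: real and A :: "real ^ 'n ^ 'm" and b :: "real ^ 'm"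
    assume "2 ^ CARD('m) * (4 * real CARD('m + 'n)) ^ (CARD('m + 'n) - 1) * M + 1 \<le> t"
      and Q: "Q \<le> t" and h: "height t A \<le> M"
    then have \<rho>t: "\<rho> \<le> t" by (simp add: \<rho>_def)
    then have t: "t > 0" "1 \<le> t" using \<rho> by auto
    have span: "span (box_points (flow_lattice t A) \<rho>) = UNIV"
      by (rule spanning_if_height_le[OF h M \<rho>_def \<rho>t])
    obtain p q \<tau> where pq: "p \<in> int_lattice" "q \<in> int_lattice"
      and q: "\<And>j. 4 * D * t ^ m \<le> q $ j" "\<And>j. q $ j \<le> 6 * D * t ^ m"
      and \<tau>: "\<And>i. 0 \<le> \<tau> i" "\<And>i. \<tau> i < 1 / t ^ d"
      and hit: "\<And>i. (A *v q) $ i + \<tau> i * (\<Sum>j\<in>UNIV. q $ j) = p $ i + b $ i"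
      by (rule hit_near[OF t(1) \<rho> span D_def, of b]) (auto simp: m_def d_def)
    define P where "P = T ^ s"
    have P: "P > 0" using T by (simp add: P_def)
    define r where "r = 1 / (t * real P) ^ d"
    have r: "r > 0" using t P by (simp add: r_def)
    define L :: "nat ^ 'n ^ 'm" where "L = (\<chi> i j. nat \<lfloor>\<tau> i / r\<rfloor>)"
    have L: "L \<in> grid (P ^ d)"
    proof -
      have "nat \<lfloor>\<tau> i / r\<rfloor> < P ^ d" for i
      proof -
        have "\<tau> i / r < (1 / t ^ d) / r" using \<tau> r by (intro divide_strict_right_mono) auto
        also have "\<dots> = real (P ^ d)" using t P by (simp add: r_def power_mult_distrib)
        finally have "\<lfloor>\<tau> i / r\<rfloor> < int (P ^ d)" by (simp only: floor_less_iff of_int_of_nat_eq)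
        moreover have "0 \<le> \<lfloor>\<tau> i / r\<rfloor>" using \<tau>(1)[of i] r by simp
        ultimately show ?thesis using nat_less_iff[of "\<lfloor>\<tau> i / r\<rfloor>" "P ^ d"] by blast
      qed
      then show ?thesis by (simp add: grid_def L_def)
    qed
    have L_close: "real (L $ i $ j) * r \<le> \<tau> i" "\<tau> i < real (L $ i $ j) * r + r" for i j
    proof -
      have "0 \<le> \<tau> i / r" using \<tau>(1)[of i] r by simp
      then have "real (L $ i $ j) = of_int \<lfloor>\<tau> i / r\<rfloor>" by (simp add: L_def)
      then have "real (L $ i $ j) \<le> \<tau> i / r" "\<tau> i / r < real (L $ i $ j) + 1" by linarith+
      then show "real (L $ i $ j) * r \<le> \<tau> i" "\<tau> i < real (L $ i $ j) * r + r"
        using r by (simp_all add: field_simps)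
    qed
    have "X \<notin> bad_from Q b \<epsilon>" if X: "X \<in> cell r (corner r A L)" for X
    proof -
      have q0: "0 \<le> q $ j" for j using q(1)[of j] D1 t by (smt (verit) mult_nonneg_nonneg zero_le_power)
      have comp: "\<bar>(X *v q - b - p) $ i\<bar> \<le> n * r * (6 * D * t ^ m)" for i
      proof -
        have "(X *v q - b - p) $ i = (\<Sum>j\<in>UNIV. X $ i $ j * q $ j) - ((A *v q) $ i + \<tau> i * (\<Sum>j\<in>UNIV. q $ j))"
          unfolding hit by (simp add: matrix_vector_mult_def)
        also have "\<dots> = (\<Sum>j\<in>UNIV. (X $ i $ j - A $ i $ j - \<tau> i) * q $ j)"
          by (simp add: matrix_vector_mult_def algebra_simps sum.distrib sum_subtractf sum_distrib_left)
        also have "\<bar>\<dots>\<bar> \<le> (\<Sum>j\<in>(UNIV :: 'n set). r * (6 * D * t ^ m))"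
        proof (rule order.trans[OF sum_abs], rule sum_mono)
          fix j
          have "A $ i $ j + real (L $ i $ j) * r \<le> X $ i $ j" "X $ i $ j < A $ i $ j + real (L $ i $ j) * r + r"
            using X by (simp_all add: cell_def corner_def mult.commute)
          then have "\<bar>X $ i $ j - A $ i $ j - \<tau> i\<bar> \<le> r" using L_close[of i j] by linarith
          then show "\<bar>(X $ i $ j - A $ i $ j - \<tau> i) * q $ j\<bar> \<le> r * (6 * D * t ^ m)"
            unfolding abs_mult using q(2)[of j] q0[of j] r by (intro mult_mono) auto
        qed
        also have "\<dots> = n * r * (6 * D * t ^ m)" by (simp add: n_def)
        finally show ?thesis .
      qed
      have "lattice_dist (X *v q - b) \<le> norm (X *v q - b - p)" by (rule lattice_dist_le[OF pq(1)])
      also have "\<dots> \<le> (\<Sum>i\<in>UNIV. \<bar>(X *v q - b - p) $ i\<bar>)" by (rule norm_le_l1_cart)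
      also have "\<dots> \<le> (\<Sum>i\<in>(UNIV :: 'm set). n * r * (6 * D * t ^ m))" by (intro sum_mono comp)
      finally have dist: "lattice_dist (X *v q - b) \<le> (6 * m * n * D) * (r * t ^ m)" by (simp add: m_def mult_ac)
      have "norm q \<le> (\<Sum>j\<in>UNIV. \<bar>q $ j\<bar>)" by (rule norm_le_l1_cart)
      also have "\<dots> \<le> (\<Sum>j\<in>(UNIV :: 'n set). 6 * D * t ^ m)" using q q0 by (intro sum_mono) simp
      finally have "norm q \<le> (6 * n * D) * t ^ m" by (simp add: n_def mult_ac)
      then have "norm q powr (real n / real m) \<le> ((6 * n * D) * t ^ m) powr (real n / real m)"
        by (intro powr_mono2) auto
      also have "\<dots> = (6 * n * D) powr (real n / real m) * (t ^ m) powr (real n / real m)"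
        using D1 t by (intro powr_mult)
      also have "(t ^ m) powr (real n / real m) = t ^ n"
        using t mn1 by (simp add: powr_powr flip: powr_realpow)
      finally have norm: "norm q powr (real n / real m) \<le> (6 * n * D) powr (real n / real m) * t ^ n" .
      have "norm q powr (real n / real m) * lattice_dist (X *v q - b)
        \<le> norm q powr (real n / real m) * ((6 * m * n * D) * (r * t ^ m))"
        by (rule mult_left_mono[OF dist]) simp
      also have "\<dots> \<le> ((6 * n * D) powr (real n / real m) * t ^ n) * ((6 * m * n * D) * (r * t ^ m))"
        using D1 r t by (intro mult_right_mono[OF norm]) auto
      also have "\<dots> = K / real P ^ d"
        using t P by (simp add: K_def r_def d power_add power_mult_distrib field_simps)
      also have "\<dots> \<le> \<epsilon>" using s \<epsilon> P by (simp add: P_def field_simps)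
      finally have "norm q powr (real n / real m) * lattice_dist (X *v q - b) \<le> \<epsilon>" .
      moreover have "Q \<le> norm q"
      proof -
        obtain j0 :: 'n where True by blast
        have "t \<le> t ^ m" using t mn1 by (intro self_le_power) auto
        also have "1 * t ^ m \<le> 4 * D * t ^ m" using D1 t by (intro mult_right_mono) auto
        also have "\<dots> \<le> q $ j0" by (rule q)
        also have "\<dots> \<le> norm q" using component_le_norm_cart[of q j0] by simp
        finally show ?thesis using Q by simp
      qed
      ultimately show ?thesis using pq(2) unfolding bad_from_def m_def n_def by force
    qed
    then show "\<exists>L\<in>grid ((T ^ s) ^ CARD('m + 'n)).
        cell (1 / (t * real (T ^ s)) ^ CARD('m + 'n)) (corner (1 / (t * real (T ^ s)) ^ CARD('m + 'n)) A L)
          \<inter> bad_from Q b \<epsilon> = {}"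
      using L unfolding r_def P_def d_def by blast
  qed (simp add: s_def)
qed

section \<open>Few cells meet the set of bad matrices\<close>

lemma cell_cover:
  fixes X :: "real ^ 'n ^ 'm" and r :: real
  assumes r: "r > 0" and X: "X \<in> cell (real N * r) A"
  shows "\<exists>L\<in>grid N. X \<in> cell r (corner r A L)"
proof -
  define z where "z i j = (X $ i $ j - A $ i $ j) / r" for i j
  have z: "0 \<le> z i j" "z i j < real N" for i j
    using X r by (simp_all add: z_def cell_def field_simps)
  define L where "L = (\<chi> i j. nat \<lfloor>z i j\<rfloor>)"
  have L: "real (L $ i $ j) \<le> z i j" "z i j < real (L $ i $ j) + 1" for i j
    using z(1)[of i j] by (simp_all add: L_def)
  have "L $ i $ j < N" for i j
    using L(1)[of i j] z(2)[of i j] by linarith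
  moreover have "X $ i $ j = A $ i $ j + r * z i j" for i j
    using r by (simp add: z_def)
  moreover have "r * real (L $ i $ j) \<le> r * z i j" "r * z i j < r * (real (L $ i $ j) + 1)" for i j
    using L[of i j] r by simp_all
  ultimately have "L \<in> grid N \<and> X \<in> cell r (corner r A L)"
    by (simp add: grid_def cell_def corner_def distrib_left)
  then show ?thesis by blast
qed

definition live :: "real \<Rightarrow> nat \<Rightarrow> (real ^ 'n ^ 'm) set \<Rightarrow> real ^ 'n ^ 'm \<Rightarrow> (nat ^ 'n ^ 'm) set" where
  "live t P B A = {L \<in> grid (P ^ CARD('m + 'n)).
     cell (1 / (t * real P) ^ CARD('m + 'n)) (corner (1 / (t * real P) ^ CARD('m + 'n)) A L) \<inter> B \<noteq> {}}"

lemma finite_live: "finite (live t P B A)"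
  unfolding live_def by (simp add: finite_grid)

text \<open>Let G be the number of subcells. Above the threshold M = 8b', half of the height is lost on average, which
outweighs both the additive constant b' and the required gain. Below it, one of the subcells is
free of bad matrices, which removes one summand K; with K = 2b'G this pays for the additive constant in all
G subcells.\<close>

lemma potential_decay:
  fixes \<epsilon> :: real
  assumes \<epsilon>: "\<epsilon> > 0"
  obtains P :: nat and c K :: real where "2 \<le> P" "0 < c" "c < 1" "0 \<le> K"
    "\<And>Q. \<exists>t0\<ge>1. \<forall>t\<ge>t0. \<forall>(A :: real ^ 'n ^ 'm) b.
       (\<Sum>L\<in>live t P (bad_from Q b \<epsilon>) A. height (t * real P) (corner (1 / (t * real P) ^ CARD('m + 'n)) A L) + K)
       \<le> (1 - c) * real (card (grid (P ^ CARD('m + 'n)) :: (nat ^ 'n ^ 'm) set)) * (height t A + K)"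
proof -
  define d where "d = CARD('m + 'n)"
  obtain T b0 where T: "2 \<le> T" and b0: "1 \<le> b0" and drift:
    "\<And>(t :: real) (A :: real ^ 'n ^ 'm). t > 0 \<Longrightarrow>
      (\<Sum>L\<in>grid (T ^ CARD('m + 'n)). height (t * real T) (corner (1 / (t * real T) ^ CARD('m + 'n)) A L))
      \<le> real (card (grid (T ^ CARD('m + 'n)) :: (nat ^ 'n ^ 'm) set)) * (height t A / 2 + b0)"
    by (rule height_drift[where ?'m='m and ?'n='n]) blast
  define b' where "b' = 2 * b0"
  define M where "M = 8 * b'"
  have M: "1 \<le> M" using b0 by (simp add: M_def b'_def)
  define t1 where "t1 = 2 ^ CARD('m) * (4 * real CARD('m + 'n)) ^ (CARD('m + 'n) - 1) * M + 1"
  have t1: "1 \<le> t1" using M by (simp add: t1_def)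
  obtain s where s: "1 \<le> s" and hit: "\<And>Q t (A :: real ^ 'n ^ 'm) b. \<lbrakk>t1 \<le> t; Q \<le> t; height t A \<le> M\<rbrakk> \<Longrightarrow>
      \<exists>L\<in>grid ((T ^ s) ^ CARD('m + 'n)).
        cell (1 / (t * real (T ^ s)) ^ CARD('m + 'n)) (corner (1 / (t * real (T ^ s)) ^ CARD('m + 'n)) A L)
          \<inter> bad_from Q b \<epsilon> = {}"
    unfolding t1_def by (rule hit_cell[OF \<epsilon> M T, where ?'m='m and ?'n='n]) blast
  define P where "P = T ^ s"
  define G where "G = real (card (grid (P ^ d) :: (nat ^ 'n ^ 'm) set))"
  have P: "2 \<le> P"
  proof -
    have "T ^ 1 \<le> T ^ s" using s T by (intro power_increasing) auto
    then show ?thesis using T by (simp add: P_def)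
  qed
  have G: "1 \<le> G" unfolding G_def card_grid using P by simp
  define K where "K = 2 * b' * G"
  define c where "c = 1 / (4 * G)"
  show ?thesis
  proof (rule that[of P c K])
    fix Q :: real
    show "\<exists>t0\<ge>1. \<forall>t\<ge>t0. \<forall>(A :: real ^ 'n ^ 'm) b.
       (\<Sum>L\<in>live t P (bad_from Q b \<epsilon>) A. height (t * real P) (corner (1 / (t * real P) ^ CARD('m + 'n)) A L) + K)
       \<le> (1 - c) * real (card (grid (P ^ CARD('m + 'n)) :: (nat ^ 'n ^ 'm) set)) * (height t A + K)"
    proof (rule exI[of _ "max t1 Q"], intro conjI allI impI)
      fix t :: real and A :: "real ^ 'n ^ 'm" and b :: "real ^ 'm"
      assume "max t1 Q \<le> t"
      then have t: "t1 \<le> t" "Q \<le> t" "0 < t" using t1 by auto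
      define h where "h = height t A"
      have h1: "1 \<le> h" unfolding h_def by (rule height_ge1[OF t(3)])
      define f where "f L = height (t * real P) (corner (1 / (t * real P) ^ d) A L)" for L
      have f0: "0 \<le> f L" for L by (simp add: f_def height_def)
      define S where "S = live t P (bad_from Q b \<epsilon>) A"
      have SG: "S \<subseteq> grid (P ^ d)" by (auto simp: S_def live_def d_def)
      have "sum f S \<le> sum f (grid (P ^ d))"
        using SG f0 by (intro sum_mono2 finite_grid) auto
      also have "\<dots> \<le> G * (h / 2 ^ s + 2 * b0 * (1 - 1 / 2 ^ s))"
        unfolding f_def G_def P_def h_def d_def by (rule height_drift_iterate[OF T _ t(3)]) (rule drift)
      also have "\<dots> \<le> G * (h / 2 + b')"
      proof (intro mult_left_mono add_mono)
        have "(2 :: real) ^ 1 \<le> 2 ^ s" using s by (intro power_increasing) auto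
        then show "h / 2 ^ s \<le> h / 2" using h1 by (intro divide_left_mono) auto
        show "2 * b0 * (1 - 1 / 2 ^ s) \<le> b'"
          using b0 unfolding b'_def by (intro mult_left_le) auto
      qed (use G in auto)
      finally have sumf: "sum f S \<le> G * (h / 2 + b')" .
      have sum: "(\<Sum>L\<in>S. f L + K) = sum f S + real (card S) * K" by (simp add: sum.distrib)
      have rhs: "(1 - c) * G * (h + K) = (G - 1 / 4) * (h + K)"
        using G by (simp add: c_def field_simps)
      have b'0: "0 \<le> G * b'" using G b0 by (simp add: b'_def)
      have KG: "K = 2 * (G * b')" by (simp add: K_def)
      have Gh: "h \<le> G * h" using G h1 by simp
      have expand: "(G - 1) * K = G * K - K" "G * (h / 2 + b') = G * h / 2 + G * b'"
        "(G - 1 / 4) * (h + K) = G * h + G * K - h / 4 - K / 4"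
        by (simp_all add: algebra_simps)
      have "(\<Sum>L\<in>S. f L + K) \<le> (G - 1 / 4) * (h + K)"
      proof (cases "h \<le> M")
        case True
        obtain L where L: "L \<in> grid (P ^ d)" "L \<notin> S"
          using hit[OF t(1,2) True[unfolded h_def], of b] by (auto simp: S_def live_def P_def d_def)
        then have "S \<subset> grid (P ^ d)" using SG by blast
        then have "card S < card (grid (P ^ d) :: (nat ^ 'n ^ 'm) set)" by (intro psubset_card_mono finite_grid)
        then have "real (card S) \<le> G - 1" unfolding G_def by linarith
        then have "real (card S) * K \<le> (G - 1) * K" using KG b'0 by (intro mult_right_mono) auto
        then have "(\<Sum>L\<in>S. f L + K) \<le> G * (h / 2 + b') + (G - 1) * K" using sum sumf by linarith
        also have "\<dots> \<le> (G - 1 / 4) * (h + K)"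
          unfolding expand using KG b'0 Gh h1 by linarith
        finally show ?thesis .
      next
        case False
        then have "G * (8 * b') \<le> G * h" using G by (intro mult_left_mono) (auto simp: M_def)
        then have "8 * (G * b') \<le> G * h" by simp
        moreover have "real (card S) \<le> G" unfolding G_def using card_mono[OF finite_grid SG] by simp
        then have "real (card S) * K \<le> G * K" using KG b'0 by (intro mult_right_mono) auto
        then have "(\<Sum>L\<in>S. f L + K) \<le> G * (h / 2 + b') + G * K" using sum sumf by linarith
        moreover have "G * (h / 2 + b') + G * K \<le> (G - 1 / 4) * (h + K)"
          unfolding expand using KG b'0 Gh \<open>8 * (G * b') \<le> G * h\<close> by linarith
        ultimately show ?thesis by linarith
      qed
      then show "(\<Sum>L\<in>live t P (bad_from Q b \<epsilon>) A. height (t * real P) (corner (1 / (t * real P) ^ CARD('m + 'n)) A L) + K)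
       \<le> (1 - c) * real (card (grid (P ^ CARD('m + 'n)) :: (nat ^ 'n ^ 'm) set)) * (height t A + K)"
        using rhs by (simp only: S_def f_def G_def h_def d_def)
    qed (use t1 in auto)
  qed (use P G b0 in \<open>auto simp: c_def K_def b'_def\<close>)
qed

primrec generation :: "real \<Rightarrow> nat \<Rightarrow> (real ^ 'n ^ 'm) set \<Rightarrow> real ^ 'n ^ 'm \<Rightarrow> nat \<Rightarrow> (real ^ 'n ^ 'm) set" where
  "generation t P B A 0 = {A}"
| "generation t P B A (Suc j) = (\<Union>A'\<in>generation t P B A j.
     corner (1 / (t * real P ^ Suc j) ^ CARD('m + 'n)) A' ` live (t * real P ^ j) P B A')"

lemma finite_generation: "finite (generation t P B A j)"
  by (induction j) (auto simp: finite_live)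

lemma generation_covers:
  fixes A :: "real ^ 'n ^ 'm" and t :: real
  assumes t: "t > 0" and P: "P > 0"
  shows "B \<inter> cell (1 / t ^ CARD('m + 'n)) A
    \<subseteq> (\<Union>A'\<in>generation t P B A j. cell (1 / (t * real P ^ j) ^ CARD('m + 'n)) A')"
proof (induction j)
  case (Suc j)
  show ?case
  proof
    fix X assume X: "X \<in> B \<inter> cell (1 / t ^ CARD('m + 'n)) A"
    define r where "r = 1 / (t * real P ^ Suc j) ^ CARD('m + 'n)"
    have r: "r > 0" using t P by (simp add: r_def)
    have r': "1 / (t * real P ^ j) ^ CARD('m + 'n) = real (P ^ CARD('m + 'n)) * r"
      using t P by (simp add: r_def power_mult_distrib)
    obtain A' where A': "A' \<in> generation t P B A j" "X \<in> cell (1 / (t * real P ^ j) ^ CARD('m + 'n)) A'"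
      using Suc X by blast
    obtain L where L: "L \<in> grid (P ^ CARD('m + 'n))" "X \<in> cell r (corner r A' L)"
      using cell_cover[OF r A'(2)[unfolded r']] by blast
    have e: "t * real P ^ j * real P = t * real P ^ Suc j" by simp
    have "L \<in> live (t * real P ^ j) P B A'"
      using L X unfolding live_def e r_def[symmetric] by blast
    then have "corner r A' L \<in> generation t P B A (Suc j)"
      using A'(1) unfolding generation.simps r_def[symmetric] by blast
    then show "X \<in> (\<Union>A'\<in>generation t P B A (Suc j). cell (1 / (t * real P ^ Suc j) ^ CARD('m + 'n)) A')"
      using L(2) unfolding r_def by blast
  qed
qed simp

text \<open>The height is at least 1, so the potential bounds the number of cells from above.\<close>

lemma card_generation_le:
  fixes A :: "real ^ 'n ^ 'm" and t K :: real
  assumes t0: "1 \<le> t0" "t0 \<le> t" and P: "1 \<le> P" and K: "0 \<le> K"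
    and decay: "\<And>t (A :: real ^ 'n ^ 'm). t0 \<le> t \<Longrightarrow>
       (\<Sum>L\<in>live t P B A. height (t * real P) (corner (1 / (t * real P) ^ CARD('m + 'n)) A L) + K) \<le> g * (height t A + K)"
    and g: "0 \<le> g"
  shows "real (card (generation t P B A j)) \<le> g ^ j * (height t A + K)"
proof -
  have tj: "t0 \<le> t * real P ^ j" "0 < t * real P ^ j" for j
  proof -
    have "t * 1 \<le> t * real P ^ j" using t0 P by (intro mult_left_mono) auto
    then show "t0 \<le> t * real P ^ j" "0 < t * real P ^ j" using t0 by linarith+
  qed
  have "(\<Sum>A'\<in>generation t P B A j. height (t * real P ^ j) A' + K) \<le> g ^ j * (height t A + K)"
  proof (induction j)
    case (Suc j)
    define u where "u = t * real P ^ j"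
    have uP: "t * real P ^ Suc j = u * real P" by (simp add: u_def)
    define r where "r = 1 / (u * real P) ^ CARD('m + 'n)"
    define F where "F A' = height (u * real P) A' + K" for A' :: "real ^ 'n ^ 'm"
    have F0: "0 \<le> F A'" for A' using K by (simp add: F_def height_def)
    have "sum F (generation t P B A (Suc j)) \<le> (\<Sum>A'\<in>generation t P B A j. sum F (corner r A' ` live u P B A'))"
      unfolding generation.simps uP r_def[symmetric] u_def[symmetric]
      by (intro sum_UN_le_nonneg finite_generation F0 finite_imageI finite_live)
    also have "\<dots> \<le> (\<Sum>A'\<in>generation t P B A j. g * (height u A' + K))"
    proof (rule sum_mono)
      fix A'
      have "sum F (corner r A' ` live u P B A') \<le> (\<Sum>L\<in>live u P B A'. F (corner r A' L))"
        using sum_image_le[OF finite_live, of u P B A' F "corner r A'"] F0 by (simp add: o_def)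
      also have "\<dots> \<le> g * (height u A' + K)"
        using decay[of u A'] tj[of j] by (simp add: F_def r_def u_def)
      finally show "sum F (corner r A' ` live u P B A') \<le> g * (height u A' + K)" .
    qed
    also have "\<dots> = g * (\<Sum>A'\<in>generation t P B A j. height u A' + K)" by (simp add: sum_distrib_left)
    also have "\<dots> \<le> g * (g ^ j * (height t A + K))"
      using Suc.IH g unfolding u_def by (intro mult_left_mono) auto
    finally show ?case unfolding F_def uP by (simp only: power_Suc mult.assoc)
  qed simp
  moreover have "real (card (generation t P B A j)) \<le> (\<Sum>A'\<in>generation t P B A j. height (t * real P ^ j) A' + K)"
  proof -
    have "(\<Sum>A'\<in>generation t P B A j. 1) \<le> (\<Sum>A'\<in>generation t P B A j. height (t * real P ^ j) A' + K)"
    proof (rule sum_mono)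
      fix A' show "1 \<le> height (t * real P ^ j) A' + K"
        using height_ge1[OF tj(2), of j A'] K by linarith
    qed
    then show ?thesis by simp
  qed
  ultimately show ?thesis by linarith
qed

section \<open>Hausdorff null sets\<close>

lemma norm_diff_cell:
  fixes A :: "real ^ 'n ^ 'm" and r :: real
  assumes "X \<in> cell r A" "Y \<in> cell r A"
  shows "norm (X - Y) \<le> CARD('m) * CARD('n) * r"
proof -
  have "norm (X - Y) \<le> (\<Sum>i\<in>UNIV. norm ((X - Y) $ i))"
    unfolding norm_vec_def by (rule L2_set_le_sum) simp
  also have "\<dots> \<le> (\<Sum>i\<in>(UNIV :: 'm set). \<Sum>j\<in>(UNIV :: 'n set). r)"
  proof (rule sum_mono, rule order.trans[OF norm_le_l1_cart], rule sum_mono)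
    fix i j
    have "A $ i $ j \<le> X $ i $ j" "X $ i $ j < A $ i $ j + r" "A $ i $ j \<le> Y $ i $ j" "Y $ i $ j < A $ i $ j + r"
      using assms by (simp_all add: cell_def)
    then show "\<bar>(X - Y) $ i $ j\<bar> \<le> r" by simp
  qed
  also have "\<dots> = CARD('m) * CARD('n) * r" by simp
  finally show ?thesis .
qed

lemma bounded_diameter_cell:
  fixes A :: "real ^ 'n ^ 'm" and r :: real
  assumes "0 \<le> r"
  shows bounded_cell: "bounded (cell r A)"
    and diameter_cell_le: "diameter (cell r A) \<le> CARD('m) * CARD('n) * r"
proof -
  show "diameter (cell r A) \<le> CARD('m) * CARD('n) * r"
    using assms by (intro diameter_le norm_diff_cell) auto
  show "bounded (cell r A)"
    unfolding bounded_two_points dist_norm using norm_diff_cell by blast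
qed

text \<open>Finite covers are completed to sequences by empty sets, which have gauge 0.\<close>

lemma hausdorff_null_if_finite_covers:
  fixes S :: "'a::metric_space set" and \<sigma> :: real
  assumes \<sigma>: "\<sigma> > 0"
    and cover: "\<And>r e. 0 < r \<Longrightarrow> 0 < e \<Longrightarrow> \<exists>F. finite F \<and> S \<subseteq> \<Union>F \<and>
      (\<forall>U\<in>F. bounded U \<and> diameter U \<le> r) \<and> (\<Sum>U\<in>F. diameter U powr \<sigma>) \<le> e"
  shows "hausdorff_measure \<sigma> S = 0"
proof -
  have pre: "hausdorff_premeasure \<sigma> r S \<le> 0 + ennreal e" if r: "0 < r" and e: "0 < e" for r e
  proof -
    obtain F where F: "finite F" "S \<subseteq> \<Union>F" "\<And>U. U \<in> F \<Longrightarrow> bounded U \<and> diameter U \<le> r"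
      "(\<Sum>U\<in>F. diameter U powr \<sigma>) \<le> e"
      using cover[OF r e] by blast
    obtain f where f: "bij_betw f {0..<card F} F" using ex_bij_betw_nat_finite[OF F(1)] by blast
    define U where "U i = (if i < card F then f i else {})" for i
    have fF: "f i \<in> F" if "i < card F" for i using f that by (auto simp: bij_betw_def)
    have "S \<subseteq> (\<Union>i. U i)"
    proof
      fix x assume "x \<in> S"
      then obtain V where "V \<in> F" "x \<in> V" using F(2) by blast
      then have "V \<in> f ` {0..<card F}" using f by (simp add: bij_betw_def)
      then obtain i where "i < card F" "f i = V" by auto
      then show "x \<in> (\<Union>i. U i)" using \<open>x \<in> V\<close> by (auto simp: U_def intro!: exI[of _ i])
    qed
    moreover have "bounded (U i) \<and> diameter (U i) \<le> r" for i
      using F(3) fF r by (auto simp: U_def)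
    ultimately have "hausdorff_premeasure \<sigma> r S \<le> (\<Sum>i. hausdorff_gauge \<sigma> (U i))"
      unfolding hausdorff_premeasure_def by (intro INF_lower) auto
    also have "\<dots> = (\<Sum>i\<in>{..<card F}. hausdorff_gauge \<sigma> (U i))"
      by (rule suminf_finite) (auto simp: U_def hausdorff_gauge_def)
    also have "\<dots> \<le> (\<Sum>i\<in>{..<card F}. ennreal (diameter (f i) powr \<sigma>))"
      using \<sigma> by (intro sum_mono) (auto simp: hausdorff_gauge_def U_def)
    also have "\<dots> = ennreal (\<Sum>i\<in>{0..<card F}. diameter (f i) powr \<sigma>)"
      by (simp add: sum_ennreal atLeast0LessThan)
    also have "(\<Sum>i\<in>{0..<card F}. diameter (f i) powr \<sigma>) = (\<Sum>U\<in>F. diameter U powr \<sigma>)"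
      by (rule sum.reindex_bij_betw[OF f])
    finally show ?thesis using F(4) by (simp add: ennreal_leI order.trans)
  qed
  have "hausdorff_premeasure \<sigma> r S \<le> 0" if "0 < r" for r
  proof (rule ennreal_le_epsilon)
    fix e :: real assume "0 < e"
    from pre[OF that this] show "hausdorff_premeasure \<sigma> r S \<le> 0 + ennreal e" .
  qed
  then have "hausdorff_measure \<sigma> S \<le> 0"
    unfolding hausdorff_measure_def by (intro SUP_least) simp
  then show ?thesis by simp
qed

lemma hausdorff_null_UN:
  fixes S :: "nat \<Rightarrow> 'a::metric_space set" and \<sigma> :: real
  assumes null: "\<And>k. hausdorff_measure \<sigma> (S k) = 0"
  shows "hausdorff_measure \<sigma> (\<Union>k. S k) = 0"
proof -
  have pre: "hausdorff_premeasure \<sigma> r (\<Union>k. S k) \<le> 0 + ennreal e" if r: "0 < r" and e: "0 < e" for r e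
  proof -
    have "\<exists>U. S k \<subseteq> (\<Union>i. U i) \<and> (\<forall>i. bounded (U i) \<and> diameter (U i) \<le> r) \<and>
      (\<Sum>i. hausdorff_gauge \<sigma> (U i)) < ennreal (e * (1/2) ^ Suc k)" for k
    proof -
      have "hausdorff_premeasure \<sigma> r (S k) \<le> hausdorff_measure \<sigma> (S k)"
        unfolding hausdorff_measure_def using r by (intro SUP_upper) simp
      also have "\<dots> < ennreal (e * (1/2) ^ Suc k)" using null e by simp
      finally show ?thesis unfolding hausdorff_premeasure_def INF_less_iff by blast
    qed
    then obtain U where U: "\<And>k. S k \<subseteq> (\<Union>i. U k i)" "\<And>k i. bounded (U k i) \<and> diameter (U k i) \<le> r"
      "\<And>k. (\<Sum>i. hausdorff_gauge \<sigma> (U k i)) < ennreal (e * (1/2) ^ Suc k)" by metis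
    define V where "V n = (case prod_decode n of (k, i) \<Rightarrow> U k i)" for n
    have "(\<Union>k. S k) \<subseteq> (\<Union>n. V n)"
    proof
      fix x assume "x \<in> (\<Union>k. S k)"
      then obtain k i where "x \<in> U k i" using U(1) by blast
      then have "x \<in> V (prod_encode (k, i))" by (simp add: V_def)
      then show "x \<in> (\<Union>n. V n)" by blast
    qed
    moreover have "bounded (V n) \<and> diameter (V n) \<le> r" for n
      using U(2) by (simp add: V_def split: prod.split)
    ultimately have "hausdorff_premeasure \<sigma> r (\<Union>k. S k) \<le> (\<Sum>n. hausdorff_gauge \<sigma> (V n))"
      unfolding hausdorff_premeasure_def by (intro INF_lower) auto
    also have "\<dots> = (\<Sum>n. (\<lambda>(k, i). hausdorff_gauge \<sigma> (U k i)) (prod_decode n))"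
      by (simp add: V_def case_prod_beta)
    also have "\<dots> = (\<Sum>k. \<Sum>i. hausdorff_gauge \<sigma> (U k i))"
      by (rule suminf_ennreal_2dimen) simp
    also have "\<dots> \<le> (\<Sum>k. ennreal (e * (1/2) ^ Suc k))"
      using U(3) by (intro suminf_le) (auto intro: less_imp_le)
    also have "\<dots> = ennreal (e * 1)"
      using e by (intro suminf_ennreal_eq sums_mult power_half_series) auto
    finally show ?thesis by simp
  qed
  have "hausdorff_premeasure \<sigma> r (\<Union>k. S k) \<le> 0" if "0 < r" for r
  proof (rule ennreal_le_epsilon)
    fix e :: real assume "0 < e"
    from pre[OF that this] show "hausdorff_premeasure \<sigma> r (\<Union>k. S k) \<le> 0 + ennreal e" .
  qed
  then have "hausdorff_measure \<sigma> (\<Union>k. S k) \<le> 0"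
    unfolding hausdorff_measure_def by (intro SUP_least) simp
  then show ?thesis by simp
qed

lemma hausdorff_null_mono:
  fixes S T :: "'a::metric_space set"
  assumes "S \<subseteq> T" "hausdorff_measure \<sigma> T = 0"
  shows "hausdorff_measure \<sigma> S = 0"
proof -
  have "hausdorff_measure \<sigma> S \<le> hausdorff_measure \<sigma> T"
    unfolding hausdorff_measure_def hausdorff_premeasure_def
    using assms(1) by (intro SUP_mono' INF_superset_mono) auto
  then show ?thesis using assms(2) by simp
qed

lemma hausdorff_null_UN_countable:
  fixes S :: "'i::countable \<Rightarrow> 'a::metric_space set" and \<sigma> :: real
  assumes "\<And>i. hausdorff_measure \<sigma> (S i) = 0"
  shows "hausdorff_measure \<sigma> (\<Union>i. S i) = 0"
proof (rule hausdorff_null_mono)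
  show "(\<Union>i. S i) \<subseteq> (\<Union>k. S (from_nat k))"
  proof
    fix x assume "x \<in> (\<Union>i. S i)"
    then obtain i where "x \<in> S i" by blast
    then have "x \<in> S (from_nat (to_nat i))" by simp
    then show "x \<in> (\<Union>k. S (from_nat k))" by blast
  qed
qed (rule hausdorff_null_UN, rule assms)

section \<open>The dimension bound\<close>

text \<open>The j-th generation covers by about \<open>g\<^sup>j\<close> sets of diameter comparable to \<open>P\<^sup>-\<^sup>d\<^sup>j\<close>, so \<open>small\<close> makes the sums
of the \<open>\<sigma>\<close>-th powers of the diameters tend to 0.\<close>

lemma hausdorff_null_Int_cell:
  fixes A :: "real ^ 'n ^ 'm" and t t0 K \<sigma> :: real and B :: "(real ^ 'n ^ 'm) set"
  assumes t0: "1 \<le> t0" "t0 \<le> t" and P: "2 \<le> P" and K: "0 \<le> K"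
    and decay: "\<And>t (A :: real ^ 'n ^ 'm). t0 \<le> t \<Longrightarrow>
       (\<Sum>L\<in>live t P B A. height (t * real P) (corner (1 / (t * real P) ^ CARD('m + 'n)) A L) + K) \<le> g * (height t A + K)"
    and g: "0 \<le> g" and \<sigma>: "0 < \<sigma>" and small: "g * (1 / real P ^ CARD('m + 'n)) powr \<sigma> < 1"
  shows "hausdorff_measure \<sigma> (B \<inter> cell (1 / t ^ CARD('m + 'n)) A) = 0"
proof (rule hausdorff_null_if_finite_covers[OF \<sigma>])
  define d where "d = CARD('m + 'n)"
  have d1: "d \<ge> 2" unfolding d_def by (rule two_le_card_sum_type)
  have t: "t > 0" and P0: "P > 0" "1 \<le> P" using t0 P by auto
  define a where "a = 1 / real P ^ d"
  have a: "0 < a" "a < 1"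
  proof -
    show "0 < a" using P0 by (simp add: a_def)
    have "1 < real P ^ d" using P d1 by (intro one_less_power) auto
    then have "1 / real P ^ d < 1 / 1" using P0 by (intro divide_strict_left_mono) auto
    then show "a < 1" by (simp add: a_def)
  qed
  define mn where "mn = real (CARD('m) * CARD('n))"
  have mn: "mn \<ge> 0" by (simp add: mn_def)
  define \<rho> where "\<rho> j = 1 / (t * real P ^ j) ^ d" for j
  have \<rho>: "\<rho> j = (1 / t ^ d) * a ^ j" for j
    by (simp add: \<rho>_def a_def power_mult_distrib power_divide mult.commute flip: power_mult)
  have \<rho>0: "0 < \<rho> j" for j using t a by (simp add: \<rho>)
  define H where "H = height t A + K"
  define C where "C = H * (mn * (1 / t ^ d)) powr \<sigma>"
  fix r e :: real assume r: "0 < r" and e: "0 < e"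
  have "(\<lambda>j. mn * \<rho> j) \<longlonglongrightarrow> mn * ((1 / t ^ d) * 0)"
    unfolding \<rho> using a by (intro tendsto_intros LIMSEQ_realpow_zero) auto
  then have ev1: "\<forall>\<^sub>F j in sequentially. mn * \<rho> j < r" using r by (auto dest: order_tendstoD(2))
  have "(\<lambda>j. C * (g * a powr \<sigma>) ^ j) \<longlonglongrightarrow> C * 0"
    using small g a unfolding a_def d_def by (intro tendsto_intros LIMSEQ_realpow_zero) auto
  then have ev2: "\<forall>\<^sub>F j in sequentially. C * (g * a powr \<sigma>) ^ j < e" using e by (auto dest: order_tendstoD(2))
  obtain j where j: "mn * \<rho> j < r" "C * (g * a powr \<sigma>) ^ j < e"
    using eventually_happens[OF eventually_conj[OF ev1 ev2]] by auto
  define F where "F = cell (\<rho> j) ` generation t P B A j"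
  have diam: "bounded U" "0 \<le> diameter U" "diameter U \<le> mn * \<rho> j" if "U \<in> F" for U
    using that less_imp_le[OF \<rho>0[of j]] unfolding F_def mn_def
    by (auto simp: bounded_cell intro!: diameter_ge_0 order.trans[OF diameter_cell_le])
  show "\<exists>F. finite F \<and> B \<inter> cell (1 / t ^ CARD('m + 'n)) A \<subseteq> \<Union>F \<and>
      (\<forall>U\<in>F. bounded U \<and> diameter U \<le> r) \<and> (\<Sum>U\<in>F. diameter U powr \<sigma>) \<le> e"
  proof (intro exI[of _ F] conjI ballI)
    show "finite F" by (simp add: F_def finite_generation)
    show "B \<inter> cell (1 / t ^ CARD('m + 'n)) A \<subseteq> \<Union>F"
      unfolding F_def \<rho>_def d_def by (rule generation_covers[OF t P0(1)])
    show "bounded U" "diameter U \<le> r" if "U \<in> F" for U using diam[OF that] j(1) by auto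
    have "(\<Sum>U\<in>F. diameter U powr \<sigma>) \<le> (\<Sum>U\<in>F. (mn * \<rho> j) powr \<sigma>)"
      using diam \<sigma> by (intro sum_mono powr_mono2) auto
    also have "\<dots> = real (card F) * (mn * \<rho> j) powr \<sigma>" by simp
    also have "real (card F) \<le> real (card (generation t P B A j))"
      unfolding F_def by (simp add: card_image_le finite_generation)
    also have "\<dots> \<le> g ^ j * H"
      unfolding H_def by (rule card_generation_le[OF t0 P0(2) K decay g])
    also have "(mn * \<rho> j) powr \<sigma> = (mn * (1 / t ^ d)) powr \<sigma> * (a powr \<sigma>) ^ j"
    proof -
      have "(a ^ j) powr \<sigma> = (a powr \<sigma>) ^ j"
        using a by (simp add: powr_powr powr_realpow[symmetric] mult.commute)
      moreover have "mn * \<rho> j = (mn * (1 / t ^ d)) * a ^ j" by (simp add: \<rho>)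
      ultimately show ?thesis by (simp only: powr_mult)
    qed
    also have "g ^ j * H * ((mn * (1 / t ^ d)) powr \<sigma> * (a powr \<sigma>) ^ j) = C * (g * a powr \<sigma>) ^ j"
      by (simp add: C_def power_mult_distrib)
    finally show "(\<Sum>U\<in>F. diameter U powr \<sigma>) \<le> e" using j(2) by (simp add: mult_right_mono)
  qed
qed

lemma Bad_subset_bad_from:
  fixes b :: "real ^ 'm"
  assumes "\<epsilon>' < \<epsilon>"
  shows "(Bad b \<epsilon> :: (real ^ 'n ^ 'm) set) \<subseteq> (\<Union>k::nat. bad_from (real k) b \<epsilon>')"
proof
  fix A :: "real ^ 'n ^ 'm" assume "A \<in> Bad b \<epsilon>"
  then have "\<forall>y<ereal \<epsilon>. \<forall>\<^sub>F q in inf at_infinity (principal int_lattice).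
      y < ereal (norm q powr (real CARD('n) / real CARD('m)) * lattice_dist (A *v q - b))"
    unfolding Bad_def eps_bad_def le_Liminf_iff by simp
  from this[rule_format, of "ereal \<epsilon>'"]
  have "\<forall>\<^sub>F q in inf at_infinity (principal int_lattice).
      ereal \<epsilon>' < ereal (norm q powr (real CARD('n) / real CARD('m)) * lattice_dist (A *v q - b))"
    using assms by simp
  then obtain R where R: "\<And>q. R \<le> norm q \<Longrightarrow> q \<in> int_lattice \<Longrightarrow>
      \<epsilon>' < norm q powr (real CARD('n) / real CARD('m)) * lattice_dist (A *v q - b)"
    unfolding eventually_inf_principal eventually_at_infinity by auto
  obtain k :: nat where "R \<le> real k" using real_arch_simple by blast
  then have "A \<in> bad_from (real k) b \<epsilon>'" unfolding bad_from_def using R by force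
  then show "A \<in> (\<Union>k::nat. bad_from (real k) b \<epsilon>')" by blast
qed

lemma grid_cells_cover:
  fixes X :: "real ^ 'n ^ 'm" and r :: real
  assumes r: "r > 0"
  shows "\<exists>Z :: int ^ 'n ^ 'm. X \<in> cell r (\<chi> i j. r * of_int (Z $ i $ j))"
proof -
  have "r * of_int \<lfloor>x / r\<rfloor> \<le> x \<and> x < r * of_int \<lfloor>x / r\<rfloor> + r" for x :: real
  proof -
    have "of_int \<lfloor>x / r\<rfloor> \<le> x / r" "x / r < of_int \<lfloor>x / r\<rfloor> + 1" by linarith+
    then have "of_int \<lfloor>x / r\<rfloor> * r \<le> x" "x < (of_int \<lfloor>x / r\<rfloor> + 1) * r"
      unfolding pos_le_divide_eq[OF r] pos_divide_less_eq[OF r] .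
    then show ?thesis by (simp only: mult.commute[of r] distrib_right mult_1_left simp_thms)
  qed
  then have "X \<in> cell r (\<chi> i j. r * of_int ((\<chi> i j. \<lfloor>X $ i $ j / r\<rfloor>) $ i $ j))"
    by (simp add: cell_def)
  then show ?thesis by blast
qed

theorem corollary1p2:
  fixes \<epsilon> :: real
  assumes "\<epsilon> > 0"
  shows "\<exists>\<delta>>0. \<forall>b :: real ^ 'm.
    hausdorff_dim (Bad b \<epsilon> :: (real ^ 'n ^ 'm) set)
      < ereal (real CARD('m) * real CARD('n) - \<delta>)"
proof -
  define d where "d = CARD('m + 'n)"
  define mn where "mn = CARD('m) * CARD('n)"
  have mn1: "mn \<ge> 1" by (simp add: mn_def Suc_leI)
  have d0: "d > 0" by (simp add: d_def)
  obtain P :: nat and c K :: real where P: "2 \<le> P" and c: "0 < c" "c < 1" and K: "0 \<le> K"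
    and decay: "\<And>Q. \<exists>t0\<ge>1. \<forall>t\<ge>t0. \<forall>(A :: real ^ 'n ^ 'm) b.
       (\<Sum>L\<in>live t P (bad_from Q b (\<epsilon> / 2)) A. height (t * real P) (corner (1 / (t * real P) ^ CARD('m + 'n)) A L) + K)
       \<le> (1 - c) * real (card (grid (P ^ CARD('m + 'n)) :: (nat ^ 'n ^ 'm) set)) * (height t A + K)"
    using potential_decay[of "\<epsilon> / 2", where ?'m='m and ?'n='n] assms by (metis half_gt_zero)
  have lnP: "ln (real P) > 0" using P by simp
  \<comment> \<open>Half of the saving log (1 / (1 - c)) is spent on lowering the exponent by \<open>2\<delta>\<close>; the minimum with 1/4 keeps
    the exponent positive.\<close>
  define \<delta> where "\<delta> = min (1 / 4) (- ln (1 - c) / (4 * d * ln (real P)))"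
  have lnc: "ln (1 - c) < 0" using c by simp
  have \<delta>: "\<delta> > 0" "\<delta> \<le> 1 / 4" "4 * d * ln (real P) * \<delta> \<le> - ln (1 - c)"
  proof -
    show "\<delta> > 0" using lnc lnP d0 by (simp add: \<delta>_def divide_neg_pos)
    show "\<delta> \<le> 1 / 4" by (simp add: \<delta>_def)
    have "\<delta> \<le> - ln (1 - c) / (4 * d * ln (real P))" by (simp add: \<delta>_def)
    then show "4 * d * ln (real P) * \<delta> \<le> - ln (1 - c)" using lnP d0 by (simp add: field_simps)
  qed
  define \<sigma> where "\<sigma> = real mn - 2 * \<delta>"
  have \<sigma>: "0 < \<sigma>" using \<delta> mn1 by (simp add: \<sigma>_def)
  define g where "g = (1 - c) * real (card (grid (P ^ d) :: (nat ^ 'n ^ 'm) set))"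
  have g: "0 \<le> g" using c by (simp add: g_def)
  have small: "g * (1 / real P ^ d) powr \<sigma> < 1"
  proof -
    have "g = (1 - c) * real P powr (d * mn)"
      using P by (simp add: g_def card_grid mn_def powr_realpow flip: power_mult of_nat_mult)
    moreover have "(1 / real P ^ d) powr \<sigma> = real P powr (- (d * \<sigma>))"
      using P by (simp add: powr_divide powr_powr powr_minus_divide powr_realpow[symmetric])
    ultimately have "g * (1 / real P ^ d) powr \<sigma> = (1 - c) * real P powr (d * mn + - (d * \<sigma>))"
      by (simp only: powr_add mult.assoc)
    also have "d * mn + - (d * \<sigma>) = 2 * d * \<delta>" by (simp add: \<sigma>_def algebra_simps)
    also have "(1 - c) * real P powr (2 * d * \<delta>) = exp (ln (1 - c) + 2 * d * \<delta> * ln (real P))"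
      using P c by (simp add: exp_add powr_def)
    also have "\<dots> < 1" using \<delta>(3) lnc by (simp add: algebra_simps)
    finally show ?thesis .
  qed
  have null: "hausdorff_measure \<sigma> (Bad b \<epsilon> :: (real ^ 'n ^ 'm) set) = 0" for b :: "real ^ 'm"
  proof (rule hausdorff_null_mono[OF Bad_subset_bad_from[of "\<epsilon> / 2"]])
    show "hausdorff_measure \<sigma> (\<Union>k::nat. bad_from (real k) b (\<epsilon> / 2) :: (real ^ 'n ^ 'm) set) = 0"
    proof (rule hausdorff_null_UN)
      fix k :: nat
      obtain t0 where t0: "1 \<le> t0" and decay_t0: "\<And>t (A :: real ^ 'n ^ 'm). t0 \<le> t \<Longrightarrow>
          (\<Sum>L\<in>live t P (bad_from (real k) b (\<epsilon> / 2)) A. height (t * real P) (corner (1 / (t * real P) ^ CARD('m + 'n)) A L) + K)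
          \<le> g * (height t A + K)"
        using decay[of "real k"] unfolding g_def d_def by blast
      define r where "r = 1 / t0 ^ d"
      have "hausdorff_measure \<sigma> (\<Union>Z :: int ^ 'n ^ 'm. bad_from (real k) b (\<epsilon> / 2) \<inter> cell r (\<chi> i j. r * of_int (Z $ i $ j))) = 0"
        unfolding r_def d_def
        by (intro hausdorff_null_UN_countable
            hausdorff_null_Int_cell[OF t0 order_refl P K decay_t0 g \<sigma> small[unfolded d_def]])
      then show "hausdorff_measure \<sigma> (bad_from (real k) b (\<epsilon> / 2) :: (real ^ 'n ^ 'm) set) = 0"
      proof (rule hausdorff_null_mono[rotated])
        have "r > 0" using t0 by (simp add: r_def)
        from grid_cells_cover[OF this]
        show "bad_from (real k) b (\<epsilon> / 2) \<subseteq>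
          (\<Union>Z :: int ^ 'n ^ 'm. bad_from (real k) b (\<epsilon> / 2) \<inter> cell r (\<chi> i j. r * of_int (Z $ i $ j)))" by blast
      qed
    qed
  qed (use assms in simp)
  show ?thesis
  proof (intro exI[of _ \<delta>] conjI allI)
    fix b :: "real ^ 'm"
    have "hausdorff_dim (Bad b \<epsilon> :: (real ^ 'n ^ 'm) set) \<le> ereal \<sigma>"
      unfolding hausdorff_dim_def using null \<sigma> by (intro INF_lower) auto
    also have "\<dots> < ereal (real CARD('m) * real CARD('n) - \<delta>)"
      using \<delta>(1) by (simp add: \<sigma>_def mn_def)
    finally show "hausdorff_dim (Bad b \<epsilon> :: (real ^ 'n ^ 'm) set) < ereal (real CARD('m) * real CARD('n) - \<delta>)" .
  qed (rule \<delta>(1))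
qed

end
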